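(* Let $\gamma$ be a power spectral density satisfying $2\alpha\beta-1>0$, and let $\mathcal{Z}_n=\gamma(-\Delta_n)\mathcal{W}_n=\sum_{k=1}^n\gamma(\lambda_k^{(n)})W_ke_k^{(n)}$ be the discretized field, where $W_1,\dots,W_n$ are independent standard Gaussian random variables. Then $\mathcal{Z}_n$ can be decomposed in the basis $\{\psi_k\}_{1\le k\le n}$ as $$\mathcal{Z}_n=\sum_{k=1}^nZ_k\psi_k,$$ where $\boldsymbol{Z}=(Z_1,\dots,Z_n)^T$ is a centered Gaussian vector with covariance matrix $$\mathrm{Var}[\boldsymbol{Z}]=\big(\sqrt{\boldsymbol{C}}\big)^{-T}\,\gamma^2(\boldsymbol{S})\,\big(\sqrt{\boldsymbol{C}}\big)^{-1},\qquad\gamma^2(\boldsymbol{S})=\boldsymbol{V}\,\mathrm{Diag}\big(\gamma(\lambda_1^{(n)})^2,\dots,\gamma(\lambda_n^{(n)})^2\big)\boldsymbol{V}^T.$$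
   Context: Setting. $(\mathcal{M},g)$ is a compact connected oriented Riemannian manifold of dimension $d\ge1$, with smooth boundary or without boundary; $\alpha=2/d$. $H=L^2(\mathcal{M},g)$ is the real $L^2$ space for the Riemannian volume measure, with inner product $(\cdot,\cdot)_0$ and norm $\Vert\cdot\Vert_0$ (also used for vector fields). $(\lambda_k,e_k)_{k\in\mathbb{N}}$ are the eigenpairs of the nonnegative Laplace--Beltrami operator $-\Delta_{\mathcal{M}}$ (Dirichlet or homogeneous Neumann boundary conditions if $\partial\mathcal{M}\neq\emptyset$), eigenvalues in non-decreasing order, $(e_k)$ an orthonormal basis of $H$; $M_0\in\{0,1\}$ is the multiplicity of the eigenvalue $0$. $\dot H^1$ is the completion of the span of the $e_k$ under $\Vert f\Vert_1^2=\sum_{k\le M_0}|(f,e_k)_0|^2+\sum_{k>M_0}\lambda_k|(f,e_k)_0|^2$. Power spectral density: $\gamma:[0,\infty)\to\mathbb{R}$ such that for some integer $\nu\ge1$, $\gamma$ is $\nu$ times differentiable with continuous derivatives up to order $\nu-1$ and $\nu$-th derivative of bounded variation; $\gamma(\lambda)\to0$ as $\lambda\to\infty$; and for some $L_\gamma,C'_\gamma,\beta>0$, $|\gamma'(\lambda)|\le C'_\gamma|\lambda|^{-(1+\beta)}$ for $\lambda\ge L_\gamma$. Discretization. $\psi_1,\dots,\psi_n\in\dot H^1$ are linearly independent, $V_n$ is their span, assumed to contain the constant functions. $-\Delta_n:V_n\to V_n$ is defined by $(-\Delta_n\varphi,v)_0=(\nabla_{\mathcal{M}}\varphi,\nabla_{\mathcal{M}}v)_0$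 for all $v\in V_n$. $\boldsymbol{C}=[(\psi_k,\psi_l)_0]_{k,l}$, $\boldsymbol{R}=[(\nabla_{\mathcal{M}}\psi_k,\nabla_{\mathcal{M}}\psi_l)_0]_{k,l}$. $\sqrt{\boldsymbol{C}}\in\mathbb{R}^{n\times n}$ is any (invertible) matrix with $\sqrt{\boldsymbol{C}}(\sqrt{\boldsymbol{C}})^T=\boldsymbol{C}$, and $(\sqrt{\boldsymbol{C}})^{-T}$ is the inverse of its transpose. $\boldsymbol{S}=(\sqrt{\boldsymbol{C}})^{-1}\boldsymbol{R}(\sqrt{\boldsymbol{C}})^{-T}$ is symmetric positive semi-definite with eigenvalues $\lambda_1^{(n)}\le\dots\le\lambda_n^{(n)}$ and orthonormal eigenvectors $\boldsymbol{v}_1,\dots,\boldsymbol{v}_n$, the columns of the orthogonal matrix $\boldsymbol{V}$, so $\boldsymbol{S}=\boldsymbol{V}\,\mathrm{Diag}(\lambda_1^{(n)},\dots,\lambda_n^{(n)})\boldsymbol{V}^T$. $e_k^{(n)}=\sum_{j=1}^n[(\sqrt{\boldsymbol{C}})^{-T}\boldsymbol{v}_k]_j\psi_j$; these form an orthonormal basis of $(V_n,\Vert\cdot\Vert_0)$ of eigenfunctions of $-\Delta_n$ with eigenvalues $\lambda_k^{(n)}$. $\gamma(-\Delta_n)\varphi=\sum_{k=1}^n\gamma(\lambda_k^{(n)})(\varphi,e_k^{(n)})_0e_k^{(n)}$ for $\varphi\in V_n$, and $\mathcal{W}_n=\sum_{k=1}^nW_ke_k^{(n)}$. *)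

theory Defs
  imports "HOL-Probability.Probability"
begin

section \<open>Smooth maps on subsets of a Euclidean space\<close>

primrec Ck_on :: "nat \<Rightarrow> 'a::real_normed_vector set \<Rightarrow> ('a \<Rightarrow> 'b::real_normed_vector) \<Rightarrow> bool" where
  "Ck_on 0 T f \<longleftrightarrow> continuous_on T f"
| "Ck_on (Suc k) T f \<longleftrightarrow>
     (\<exists>f'. (\<forall>x\<in>T. (f has_derivative f' x) (at x)) \<and> (\<forall>v. Ck_on k T (\<lambda>x. f' x v)))"

text \<open>As usual for sets with boundary, smoothness on an arbitrary set means that there are local
  smooth extensions to open sets.\<close>

definition smooth_on :: "'a::real_normed_vector set \<Rightarrow> ('a \<Rightarrow> 'b::real_normed_vector) \<Rightarrow> bool" where
  "smooth_on S f \<longleftrightarrow>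
     (\<forall>x\<in>S. \<exists>T g. open T \<and> x \<in> T \<and> (\<forall>k. Ck_on k T g) \<and> (\<forall>y\<in>S \<inter> T. g y = f y))"


section \<open>Compact connected oriented Riemannian manifolds with or without boundary\<close>

text \<open>A chart is a pair of its domain and its coordinate map. The dimension of the manifold is
  \<open>CARD('d)\<close>.\<close>

type_synonym ('a, 'd) chart = "'a set \<times> ('a \<Rightarrow> real ^ 'd)"

text \<open>\<open>metric M c p\<close> is the matrix of the Riemannian metric at the point \<open>p\<close> in the coordinates of
  the chart \<open>c\<close>.\<close>

record ('a, 'd) riem =
  pts :: "'a topology"
  charts :: "('a, 'd) chart set"
  metric :: "('a, 'd) chart \<Rightarrow> 'a \<Rightarrow> real ^ 'd ^ 'd"

abbreviation chart_inv :: "('a, 'd::finite) chart \<Rightarrow> real ^ 'd \<Rightarrow> 'a" where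
  "chart_inv c \<equiv> inv_into (fst c) (snd c)"

text \<open>The range of a chart is relatively open in a closed half-space \<open>{x. 0 \<le> b \<bullet> x}\<close>. The normal
  \<open>b\<close> may depend on the chart, and \<open>b = 0\<close> gives the whole space. (A single half-space for all
  charts would be too restrictive for oriented atlases in dimension one.)\<close>

definition chart_side :: "('a, 'd::finite) chart \<Rightarrow> real ^ 'd \<Rightarrow> bool" where
  "chart_side c b \<longleftrightarrow> openin (top_of_set {x. 0 \<le> b \<bullet> x}) (snd c ` fst c)"

definition transition_jacobian ::
    "('a, 'd::finite) chart \<Rightarrow> ('a, 'd) chart \<Rightarrow> 'a \<Rightarrow> real ^ 'd ^ 'd" where
  "transition_jacobian c c' p =
     matrix (frechet_derivative (snd c' \<circ> chart_inv c) (at (snd c p) within snd c ` (fst c \<inter> fst c')))"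

definition oriented_atlas :: "'a topology \<Rightarrow> ('a, 'd::finite) chart set \<Rightarrow> bool" where
  "oriented_atlas X A \<longleftrightarrow>
     \<Union> (fst ` A) = topspace X \<and>
     (\<forall>c\<in>A. openin X (fst c) \<and> (\<exists>b. chart_side c b) \<and>
        homeomorphic_map (subtopology X (fst c)) (top_of_set (snd c ` fst c)) (snd c)) \<and>
     (\<forall>c\<in>A. \<forall>c'\<in>A. smooth_on (snd c ` (fst c \<inter> fst c')) (snd c' \<circ> chart_inv c) \<and>
        (\<forall>p\<in>fst c \<inter> fst c'. det (transition_jacobian c c' p) > 0))"

definition riemannian_metric :: "('a, 'd::finite) riem \<Rightarrow> bool" where
  "riemannian_metric M \<longleftrightarrow>
     (\<forall>c\<in>charts M. smooth_on (snd c ` fst c) (metric M c \<circ> chart_inv c) \<and>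
        (\<forall>p\<in>fst c. transpose (metric M c p) = metric M c p \<and>
           (\<forall>x. x \<noteq> 0 \<longrightarrow> x \<bullet> (metric M c p *v x) > 0))) \<and>
     (\<forall>c\<in>charts M. \<forall>c'\<in>charts M. \<forall>p\<in>fst c \<inter> fst c'.
        metric M c p =
          transpose (transition_jacobian c c' p) ** metric M c' p ** transition_jacobian c c' p)"

definition compact_riemannian_manifold :: "('a, 'd::finite) riem \<Rightarrow> bool" where
  "compact_riemannian_manifold M \<longleftrightarrow>
     topspace (pts M) \<noteq> {} \<and> Hausdorff_space (pts M) \<and> compact_space (pts M) \<and>
     connected_space (pts M) \<and> oriented_atlas (pts M) (charts M) \<and> riemannian_metric M"

definition manifold_boundary :: "('a, 'd::finite) riem \<Rightarrow> 'a set" where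
  "manifold_boundary M = {p. \<exists>c\<in>charts M. p \<in> fst c \<and> snd c p \<notin> interior (snd c ` fst c)}"

text \<open>The Borel measure with density \<open>sqrt (det g)\<close> in every chart; this determines the measure.\<close>

definition riemannian_volume :: "('a, 'd::finite) riem \<Rightarrow> 'a measure \<Rightarrow> bool" where
  "riemannian_volume M vol \<longleftrightarrow>
     space vol = topspace (pts M) \<and>
     sets vol = sigma_sets (topspace (pts M)) {U. openin (pts M) U} \<and>
     (\<forall>c\<in>charts M. \<forall>B\<in>sets vol. B \<subseteq> fst c \<longrightarrow>
        emeasure vol B =
          (\<integral>\<^sup>+x. ennreal (sqrt (det (metric M c (chart_inv c x)))) * indicator (snd c ` B) x \<partial>lborel))"


section \<open>Square-integrable functions and vector fields\<close>

text \<open>Elements of \<open>L\<^sup>2\<close> are represented by functions; equality in \<open>L\<^sup>2\<close> is equality almost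
  everywhere.\<close>

definition sq_integrable :: "'a measure \<Rightarrow> ('a \<Rightarrow> real) \<Rightarrow> bool" where
  "sq_integrable vol f \<longleftrightarrow> f \<in> borel_measurable vol \<and> integrable vol (\<lambda>x. (f x)\<^sup>2)"

definition l2_inner :: "'a measure \<Rightarrow> ('a \<Rightarrow> real) \<Rightarrow> ('a \<Rightarrow> real) \<Rightarrow> real" where
  "l2_inner vol f h = (\<integral>x. f x * h x \<partial>vol)"

definition l2_norm :: "'a measure \<Rightarrow> ('a \<Rightarrow> real) \<Rightarrow> real" where
  "l2_norm vol f = sqrt (l2_inner vol f f)"

text \<open>A vector field is given by its components in each chart.\<close>

type_synonym ('a, 'd) field = "('a, 'd) chart \<Rightarrow> 'a \<Rightarrow> real ^ 'd"

definition vector_field :: "('a, 'd::finite) riem \<Rightarrow> ('a, 'd) field \<Rightarrow> bool" where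
  "vector_field M X \<longleftrightarrow>
     (\<forall>c\<in>charts M. \<forall>c'\<in>charts M. \<forall>p\<in>fst c \<inter> fst c'. X c' p = transition_jacobian c c' p *v X c p)"

text \<open>For vector fields the choice of the chart around \<open>p\<close> is immaterial.\<close>

definition metric_inner ::
    "('a, 'd::finite) riem \<Rightarrow> 'a \<Rightarrow> ('a, 'd) field \<Rightarrow> ('a, 'd) field \<Rightarrow> real" where
  "metric_inner M p X Y =
     (let c = SOME c. c \<in> charts M \<and> p \<in> fst c in X c p \<bullet> (metric M c p *v Y c p))"

definition field_inner ::
    "('a, 'd::finite) riem \<Rightarrow> 'a measure \<Rightarrow> ('a, 'd) field \<Rightarrow> ('a, 'd) field \<Rightarrow> real" where
  "field_inner M vol X Y = (\<integral>p. metric_inner M p X Y \<partial>vol)"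

definition field_norm :: "('a, 'd::finite) riem \<Rightarrow> 'a measure \<Rightarrow> ('a, 'd) field \<Rightarrow> real" where
  "field_norm M vol X = sqrt (field_inner M vol X X)"

definition sq_integrable_field ::
    "('a, 'd::finite) riem \<Rightarrow> 'a measure \<Rightarrow> ('a, 'd) field \<Rightarrow> bool" where
  "sq_integrable_field M vol X \<longleftrightarrow>
     vector_field M X \<and>
     (\<forall>c\<in>charts M. X c \<in> borel_measurable (restrict_space vol (fst c))) \<and>
     integrable vol (\<lambda>p. metric_inner M p X X)"


section \<open>Gradient and Laplace--Beltrami operator on smooth functions\<close>

definition smooth_fun :: "('a, 'd::finite) riem \<Rightarrow> ('a \<Rightarrow> real) \<Rightarrow> bool" where
  "smooth_fun M f \<longleftrightarrow> (\<forall>c\<in>charts M. smooth_on (snd c ` fst c) (f \<circ> chart_inv c))"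

definition chart_partial :: "('a, 'd::finite) chart \<Rightarrow> 'd \<Rightarrow> ('a \<Rightarrow> real) \<Rightarrow> 'a \<Rightarrow> real" where
  "chart_partial c i f p =
     frechet_derivative (f \<circ> chart_inv c) (at (snd c p) within snd c ` fst c) (axis i 1)"

definition smooth_grad :: "('a, 'd::finite) riem \<Rightarrow> ('a \<Rightarrow> real) \<Rightarrow> ('a, 'd) field" where
  "smooth_grad M f c p = matrix_inv (metric M c p) *v (\<chi> j. chart_partial c j f p)"

text \<open>\<open>(det g)\<^sup>-\<^sup>1\<^sup>/\<^sup>2 \<Sum>\<^sub>i \<partial>\<^sub>i ((det g)\<^sup>1\<^sup>/\<^sup>2 \<Sum>\<^sub>j g\<^sup>i\<^sup>j \<partial>\<^sub>j f)\<close> in the chart \<open>c\<close>.\<close>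

definition laplace_beltrami ::
    "('a, 'd::finite) riem \<Rightarrow> ('a, 'd) chart \<Rightarrow> ('a \<Rightarrow> real) \<Rightarrow> 'a \<Rightarrow> real" where
  "laplace_beltrami M c f p =
     (\<Sum>i\<in>UNIV. chart_partial c i (\<lambda>q. sqrt (det (metric M c q)) * smooth_grad M f c q $ i) p)
       / sqrt (det (metric M c p))"

definition dirichlet_bc :: "('a, 'd::finite) riem \<Rightarrow> ('a \<Rightarrow> real) \<Rightarrow> bool" where
  "dirichlet_bc M f \<longleftrightarrow> (\<forall>p\<in>manifold_boundary M. f p = 0)"

text \<open>If the chart \<open>c\<close> takes values in \<open>{x. 0 \<le> b \<bullet> x}\<close>, then at boundary points the \<open>g\<close>-normal
  direction is \<open>g\<^sup>-\<^sup>1 b\<close>, so the normal derivative of \<open>f\<close> is a nonzero multiple of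
  \<open>g(grad f, g\<^sup>-\<^sup>1 b) = b \<bullet> grad f\<close>.\<close>

definition neumann_bc :: "('a, 'd::finite) riem \<Rightarrow> ('a \<Rightarrow> real) \<Rightarrow> bool" where
  "neumann_bc M f \<longleftrightarrow>
     (\<forall>p\<in>manifold_boundary M. \<forall>c\<in>charts M. \<forall>b.
        p \<in> fst c \<and> chart_side c b \<longrightarrow> b \<bullet> smooth_grad M f c p = 0)"

definition laplace_eigenpairs ::
    "('a, 'd::finite) riem \<Rightarrow> 'a measure \<Rightarrow> (nat \<Rightarrow> real) \<Rightarrow> (nat \<Rightarrow> 'a \<Rightarrow> real) \<Rightarrow> bool" where
  "laplace_eigenpairs M vol lam e \<longleftrightarrow>
     mono lam \<and>
     (\<forall>k. smooth_fun M (e k)) \<and>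
     (\<forall>k. \<forall>c\<in>charts M. \<forall>p\<in>fst c. - laplace_beltrami M c (e k) p = lam k * e k p) \<and>
     ((\<forall>k. dirichlet_bc M (e k)) \<or> (\<forall>k. neumann_bc M (e k))) \<and>
     (\<forall>k. sq_integrable vol (e k)) \<and>
     (\<forall>k l. l2_inner vol (e k) (e l) = (if k = l then 1 else 0)) \<and>
     (\<forall>f. sq_integrable vol f \<longrightarrow>
        (\<lambda>N. l2_norm vol (\<lambda>x. f x - (\<Sum>k<N. l2_inner vol f (e k) * e k x))) \<longlonglongrightarrow> 0)"


section \<open>The energy space of the Laplacian and the gradient on it\<close>

definition eigen_span :: "(nat \<Rightarrow> 'a \<Rightarrow> real) \<Rightarrow> ('a \<Rightarrow> real) set" where
  "eigen_span e = {f. \<exists>N a. f = (\<lambda>x. \<Sum>k<N. a k * e k x)}"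

definition h1_norm ::
    "'a measure \<Rightarrow> (nat \<Rightarrow> real) \<Rightarrow> (nat \<Rightarrow> 'a \<Rightarrow> real) \<Rightarrow> ('a \<Rightarrow> real) \<Rightarrow> real" where
  "h1_norm vol lam e f =
     (let m = card {k. lam k = 0} in
      sqrt ((\<Sum>k<m. (l2_inner vol f (e k))\<^sup>2)
            + (\<Sum>k. lam (m + k) * (l2_inner vol f (e (m + k)))\<^sup>2)))"

text \<open>The completion of the span of the eigenfunctions, realised inside \<open>L\<^sup>2\<close>: limits in \<open>L\<^sup>2\<close> of
  sequences in the span that are Cauchy for \<open>h1_norm\<close>.\<close>

definition h1_space ::
    "'a measure \<Rightarrow> (nat \<Rightarrow> real) \<Rightarrow> (nat \<Rightarrow> 'a \<Rightarrow> real) \<Rightarrow> ('a \<Rightarrow> real) set" where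
  "h1_space vol lam e =
     {f. sq_integrable vol f \<and>
         (\<exists>F. (\<forall>m. F m \<in> eigen_span e) \<and>
              (\<forall>\<epsilon>>0. \<exists>N. \<forall>m\<ge>N. \<forall>k\<ge>N. h1_norm vol lam e (\<lambda>x. F m x - F k x) < \<epsilon>) \<and>
              (\<lambda>m. l2_norm vol (\<lambda>x. F m x - f x)) \<longlonglongrightarrow> 0)}"

text \<open>\<open>D\<close> is the bounded linear extension to the completion of the gradient of the functions in the
  span of the eigenfunctions; this determines \<open>D f\<close> up to a null set.\<close>

definition gradient_on_h1 ::
    "('a, 'd::finite) riem \<Rightarrow> 'a measure \<Rightarrow> (nat \<Rightarrow> real) \<Rightarrow> (nat \<Rightarrow> 'a \<Rightarrow> real) \<Rightarrow>
     (('a \<Rightarrow> real) \<Rightarrow> ('a, 'd) field) \<Rightarrow> bool" where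
  "gradient_on_h1 M vol lam e D \<longleftrightarrow>
     (\<forall>f\<in>h1_space vol lam e. sq_integrable_field M vol (D f)) \<and>
     (\<forall>f\<in>eigen_span e. AE p in vol. \<forall>c\<in>charts M. p \<in> fst c \<longrightarrow> D f c p = smooth_grad M f c p) \<and>
     (\<forall>f\<in>h1_space vol lam e. \<forall>h\<in>h1_space vol lam e. \<forall>a b.
        AE p in vol. \<forall>c\<in>charts M. p \<in> fst c \<longrightarrow>
          D (\<lambda>x. a * f x + b * h x) c p = a *\<^sub>R D f c p + b *\<^sub>R D h c p) \<and>
     (\<exists>K. \<forall>f\<in>h1_space vol lam e. field_norm M vol (D f) \<le> K * h1_norm vol lam e f)"


section \<open>Power spectral densities\<close>

definition bounded_variation_nonneg :: "(real \<Rightarrow> real) \<Rightarrow> bool" where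
  "bounded_variation_nonneg f \<longleftrightarrow>
     (\<exists>B. \<forall>t m. 0 \<le> t 0 \<and> mono t \<longrightarrow> (\<Sum>i<m. \<bar>f (t (Suc i)) - f (t i)\<bar>) \<le> (B::real))"

text \<open>\<open>G j\<close> is the \<open>j\<close>-th derivative on \<open>[0,\<infinity>)\<close>, one-sided at 0. The values of \<open>\<gamma>\<close> on the negative
  reals are irrelevant.\<close>

definition power_spectral_density :: "real \<Rightarrow> (real \<Rightarrow> real) \<Rightarrow> bool" where
  "power_spectral_density \<beta> \<gamma> \<longleftrightarrow>
     (\<gamma> \<longlongrightarrow> 0) at_top \<and> \<beta> > 0 \<and>
     (\<exists>\<nu> G. \<nu> \<ge> (1::nat) \<and> G 0 = \<gamma> \<and>
        (\<forall>j<\<nu>. \<forall>x\<ge>0. (G j has_real_derivative G (Suc j) x) (at x within {0..})) \<and>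
        (\<forall>j<\<nu>. continuous_on {0..} (G j)) \<and>
        bounded_variation_nonneg (G \<nu>) \<and>
        (\<exists>L>0. \<exists>C>0. \<forall>x\<ge>L. \<bar>G 1 x\<bar> \<le> C * \<bar>x\<bar> powr (- (1 + \<beta>))))"


section \<open>Galerkin discretization\<close>

text \<open>The number of basis functions is \<open>CARD('n)\<close>.\<close>

definition lin_span :: "('n::finite \<Rightarrow> 'a \<Rightarrow> real) \<Rightarrow> ('a \<Rightarrow> real) set" where
  "lin_span \<psi> = {f. \<exists>a. f = (\<lambda>x. \<Sum>j\<in>UNIV. a j * \<psi> j x)}"

definition l2_independent :: "'a measure \<Rightarrow> ('n::finite \<Rightarrow> 'a \<Rightarrow> real) \<Rightarrow> bool" where
  "l2_independent vol \<psi> \<longleftrightarrow>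
     (\<forall>a. (AE x in vol. (\<Sum>j\<in>UNIV. a j * \<psi> j x) = 0) \<longrightarrow> (\<forall>j. a j = 0))"

definition galerkin_basis ::
    "'a measure \<Rightarrow> (nat \<Rightarrow> real) \<Rightarrow> (nat \<Rightarrow> 'a \<Rightarrow> real) \<Rightarrow> ('n::finite \<Rightarrow> 'a \<Rightarrow> real) \<Rightarrow> bool" where
  "galerkin_basis vol lam e \<psi> \<longleftrightarrow>
     (\<forall>j. \<psi> j \<in> h1_space vol lam e) \<and> l2_independent vol \<psi> \<and>
     (\<forall>r. \<exists>\<phi>\<in>lin_span \<psi>. AE x in vol. \<phi> x = r)"

text \<open>Since \<open>\<psi>\<close> is linearly independent in \<open>L\<^sup>2\<close>, two elements of \<open>lin_span \<psi>\<close> that agree almost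
  everywhere are equal, so the function described here is unique.\<close>

definition discrete_neg_laplacian ::
    "('a, 'd::finite) riem \<Rightarrow> 'a measure \<Rightarrow> (('a \<Rightarrow> real) \<Rightarrow> ('a, 'd) field) \<Rightarrow>
     ('n::finite \<Rightarrow> 'a \<Rightarrow> real) \<Rightarrow> ('a \<Rightarrow> real) \<Rightarrow> 'a \<Rightarrow> real" where
  "discrete_neg_laplacian M vol D \<psi> \<phi> =
     (THE w. w \<in> lin_span \<psi> \<and> (\<forall>v\<in>lin_span \<psi>. l2_inner vol w v = field_inner M vol (D \<phi>) (D v)))"

definition orthonormal_eigenbasis ::
    "'a measure \<Rightarrow> ('n::finite \<Rightarrow> 'a \<Rightarrow> real) \<Rightarrow> (('a \<Rightarrow> real) \<Rightarrow> 'a \<Rightarrow> real) \<Rightarrow>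
     ('n \<Rightarrow> real) \<Rightarrow> ('n \<Rightarrow> 'a \<Rightarrow> real) \<Rightarrow> bool" where
  "orthonormal_eigenbasis vol \<psi> T \<mu> u \<longleftrightarrow>
     lin_span u = lin_span \<psi> \<and>
     (\<forall>k l. l2_inner vol (u k) (u l) = (if k = l then 1 else 0)) \<and>
     (\<forall>k. T (u k) = (\<lambda>x. \<mu> k * u k x))"

text \<open>\<open>g(T)\<close> for an operator \<open>T\<close> on \<open>lin_span \<psi>\<close> that is diagonalizable in an orthonormal basis:
  \<open>g(T) \<phi> = \<Sum>\<^sub>k g(\<mu>\<^sub>k) (\<phi>, u\<^sub>k)\<^sub>0 u\<^sub>k\<close>. The result does not depend on the eigenbasis chosen.\<close>

definition operator_function ::
    "(real \<Rightarrow> real) \<Rightarrow> 'a measure \<Rightarrow> ('n::finite \<Rightarrow> 'a \<Rightarrow> real) \<Rightarrow> (('a \<Rightarrow> real) \<Rightarrow> 'a \<Rightarrow> real) \<Rightarrow>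
     ('a \<Rightarrow> real) \<Rightarrow> 'a \<Rightarrow> real" where
  "operator_function g vol \<psi> T \<phi> =
     (let (\<mu>, u) = (SOME (\<mu>, u). orthonormal_eigenbasis vol \<psi> T \<mu> u)
      in (\<lambda>x. \<Sum>k\<in>UNIV. g (\<mu> k) * l2_inner vol \<phi> (u k) * u k x))"

definition mass_matrix :: "'a measure \<Rightarrow> ('n::finite \<Rightarrow> 'a \<Rightarrow> real) \<Rightarrow> real ^ 'n ^ 'n" where
  "mass_matrix vol \<psi> = (\<chi> k l. l2_inner vol (\<psi> k) (\<psi> l))"

definition stiffness_matrix ::
    "('a, 'd::finite) riem \<Rightarrow> 'a measure \<Rightarrow> (('a \<Rightarrow> real) \<Rightarrow> ('a, 'd) field) \<Rightarrow>
     ('n::finite \<Rightarrow> 'a \<Rightarrow> real) \<Rightarrow> real ^ 'n ^ 'n" where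
  "stiffness_matrix M vol D \<psi> = (\<chi> k l. field_inner M vol (D (\<psi> k)) (D (\<psi> l)))"

definition diag_matrix :: "('n::finite \<Rightarrow> real) \<Rightarrow> real ^ 'n ^ 'n" where
  "diag_matrix d = (\<chi> i j. if i = j then d i else 0)"

definition discrete_eigenfunction ::
    "real ^ 'n ^ 'n \<Rightarrow> real ^ 'n ^ 'n \<Rightarrow> ('n::finite \<Rightarrow> 'a \<Rightarrow> real) \<Rightarrow> 'n \<Rightarrow> 'a \<Rightarrow> real" where
  "discrete_eigenfunction sqrtC V \<psi> k =
     (\<lambda>x. \<Sum>j\<in>UNIV. (matrix_inv (transpose sqrtC) *v column k V) $ j * \<psi> j x)"


section \<open>Gaussian vectors\<close>

text \<open>Constants count as Gaussian, so that covariance matrices may be singular.\<close>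

definition gaussian_variable :: "'w measure \<Rightarrow> ('w \<Rightarrow> real) \<Rightarrow> bool" where
  "gaussian_variable P X \<longleftrightarrow>
     (\<exists>m \<sigma>. \<sigma> > 0 \<and> distributed P lborel X (normal_density m \<sigma>)) \<or>
     (X \<in> borel_measurable P \<and> (\<exists>m. AE \<omega> in P. X \<omega> = m))"

definition gaussian_vector :: "'w measure \<Rightarrow> ('w \<Rightarrow> real ^ 'n::finite) \<Rightarrow> bool" where
  "gaussian_vector P Z \<longleftrightarrow>
     Z \<in> borel_measurable P \<and> (\<forall>a. gaussian_variable P (\<lambda>\<omega>. a \<bullet> Z \<omega>))"

definition centered_vector :: "'w measure \<Rightarrow> ('w \<Rightarrow> real ^ 'n::finite) \<Rightarrow> bool" where
  "centered_vector P Z \<longleftrightarrow> (\<forall>k. (\<integral>\<omega>. Z \<omega> $ k \<partial>P) = 0)"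

definition covariance_matrix :: "'w measure \<Rightarrow> ('w \<Rightarrow> real ^ 'n::finite) \<Rightarrow> real ^ 'n ^ 'n" where
  "covariance_matrix P Z =
     (\<chi> k l. \<integral>\<omega>. (Z \<omega> $ k - (\<integral>\<omega>'. Z \<omega>' $ k \<partial>P)) * (Z \<omega> $ l - (\<integral>\<omega>'. Z \<omega>' $ l \<partial>P)) \<partial>P)"

end

theory Submission
  imports Defs
begin

text \<open>With \<open>A = (sqrtC)\<^sup>-\<^sup>T V\<close> the coordinate vectors of the \<open>en k\<close> are the columns of \<open>A\<close>, and
  \<open>A\<^sup>T C A = 1\<close>, \<open>A\<^sup>T R A = Diag lamn\<close>. Hence in the coordinates \<open>x \<mapsto> lincomb \<psi> (A x)\<close> the \<open>L\<^sup>2\<close> inner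
  product is the standard one and the discrete Laplacian is diagonal, so that \<open>\<gamma>\<close> of it is
  \<open>Diag (\<gamma> (lamn k))\<close> whichever eigenbasis is used to define it. Therefore \<open>Z = L W\<close> with
  \<open>L = A Diag (\<gamma> (lamn k))\<close>, a linear image of a standard Gaussian vector, with covariance \<open>L L\<^sup>T\<close>.
  The analytic input is the bilinearity of the energy form on the span of the \<open>\<psi> j\<close>, which needs that
  \<open>h1_space\<close> is a vector space and that inner products of square-integrable fields are measurable.\<close>

section \<open>Square-integrable functions and the energy space\<close>

lemma sq_integrable_mult:
  assumes "sq_integrable vol f" "sq_integrable vol h"
  shows "integrable vol (\<lambda>x. f x * h x)"
proof (rule Bochner_Integration.integrable_bound)
  show "integrable vol (\<lambda>x. (f x)\<^sup>2 + (h x)\<^sup>2)"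
    using assms by (auto simp: sq_integrable_def)
  show "(\<lambda>x. f x * h x) \<in> borel_measurable vol"
    using assms by (auto simp: sq_integrable_def)
  have "\<bar>a * b\<bar> \<le> a\<^sup>2 + b\<^sup>2" for a b :: real
  proof -
    have "2 * \<bar>a * b\<bar> \<le> a\<^sup>2 + b\<^sup>2"
      using sum_squares_bound[of "\<bar>a\<bar>" "\<bar>b\<bar>"] by (simp add: abs_mult mult.assoc)
    then show ?thesis using abs_ge_zero[of "a * b"] by linarith
  qed
  then show "AE x in vol. norm (f x * h x) \<le> norm ((f x)\<^sup>2 + (h x)\<^sup>2)"
    by simp
qed

lemma sq_integrable_lincomb:
  assumes "sq_integrable vol f" "sq_integrable vol h"
  shows "sq_integrable vol (\<lambda>x. a * f x + b * h x)"
proof -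
  have "(\<lambda>x. (a * f x + b * h x)\<^sup>2) =
      (\<lambda>x. a\<^sup>2 * (f x)\<^sup>2 + 2 * a * b * (f x * h x) + b\<^sup>2 * (h x)\<^sup>2)"
    by (auto simp: power2_eq_square algebra_simps)
  then show ?thesis
    using assms sq_integrable_mult[OF assms] by (auto simp: sq_integrable_def)
qed

lemma sq_integrable_diff:
  "sq_integrable vol f \<Longrightarrow> sq_integrable vol h \<Longrightarrow> sq_integrable vol (\<lambda>x. f x - h x)"
  using sq_integrable_lincomb[of vol f h 1 "-1"] by simp

lemma sq_integrable_sum:
  assumes "\<And>j. j \<in> J \<Longrightarrow> sq_integrable vol (f j)"
  shows "sq_integrable vol (\<lambda>x. \<Sum>j\<in>J. a j * f j x)"
  using assms
proof (induction J rule: infinite_finite_induct)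
  case (insert j J)
  then show ?case
    using sq_integrable_lincomb[of vol "f j" "\<lambda>x. \<Sum>j\<in>J. a j * f j x" "a j" 1] by simp
qed (auto simp: sq_integrable_def)

lemma l2_inner_commute: "l2_inner vol f h = l2_inner vol h f"
  by (simp add: l2_inner_def mult.commute)

lemma l2_inner_self_nonneg: "0 \<le> l2_inner vol f f"
  by (simp add: l2_inner_def)

lemma l2_inner_lincomb_left:
  assumes "sq_integrable vol f" "sq_integrable vol h" "sq_integrable vol k"
  shows "l2_inner vol (\<lambda>x. a * f x + b * h x) k = a * l2_inner vol f k + b * l2_inner vol h k"
  using sq_integrable_mult[OF assms(1,3)] sq_integrable_mult[OF assms(2,3)]
  by (simp add: l2_inner_def distrib_right mult.assoc)

lemma l2_inner_sum_left:
  assumes "\<And>j. j \<in> J \<Longrightarrow> sq_integrable vol (f j)" "sq_integrable vol k"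
  shows "l2_inner vol (\<lambda>x. \<Sum>j\<in>J. a j * f j x) k = (\<Sum>j\<in>J. a j * l2_inner vol (f j) k)"
  using sq_integrable_mult[OF assms(1) assms(2)]
  by (simp add: l2_inner_def sum_distrib_right mult.assoc)

lemma l2_inner_eq_0_imp_AE:
  assumes "sq_integrable vol f" "l2_inner vol f f = 0"
  shows "AE x in vol. f x = 0"
proof -
  have "integrable vol (\<lambda>x. f x * f x)"
    using sq_integrable_mult[OF assms(1,1)] .
  then have "AE x in vol. f x * f x = 0"
    using assms(2) by (subst integral_nonneg_eq_0_iff_AE[symmetric]) (auto simp: l2_inner_def)
  then show ?thesis by simp
qed

lemma l2_norm_power2: "(l2_norm vol f)\<^sup>2 = l2_inner vol f f"
  by (simp add: l2_norm_def l2_inner_self_nonneg)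

lemma square_lincomb_le:
  fixes a b x y :: real
  shows "(a * x + b * y)\<^sup>2 \<le> 2 * a\<^sup>2 * x\<^sup>2 + 2 * b\<^sup>2 * y\<^sup>2"
  using sum_squares_bound[of "a * x" "b * y"] by (simp add: power2_eq_square algebra_simps)

text \<open>Stands in for the triangle inequality, integrated from the pointwise bound. The lost
  factor 2 is harmless, since the bound only serves to transfer convergence to 0.\<close>

lemma l2_norm_lincomb_le:
  assumes "sq_integrable vol f" "sq_integrable vol h"
  shows "(l2_norm vol (\<lambda>x. a * f x + b * h x))\<^sup>2 \<le> 2 * a\<^sup>2 * (l2_norm vol f)\<^sup>2 + 2 * b\<^sup>2 * (l2_norm vol h)\<^sup>2"
proof -
  have "(\<integral>x. (a * f x + b * h x)\<^sup>2 \<partial>vol) \<le> (\<integral>x. 2 * a\<^sup>2 * (f x)\<^sup>2 + 2 * b\<^sup>2 * (h x)\<^sup>2 \<partial>vol)"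
    using assms sq_integrable_lincomb[OF assms, of a b]
    by (intro integral_mono square_lincomb_le) (auto simp: sq_integrable_def)
  also have "\<dots> = 2 * a\<^sup>2 * (\<integral>x. (f x)\<^sup>2 \<partial>vol) + 2 * b\<^sup>2 * (\<integral>x. (h x)\<^sup>2 \<partial>vol)"
    using assms by (simp add: sq_integrable_def)
  finally show ?thesis
    by (simp add: l2_norm_power2 l2_inner_def power2_eq_square[symmetric])
qed

text \<open>Bessel's inequality for a single unit vector: with \<open>c\<close> the coefficient of
  \<open>f\<close>, the square norm of \<open>f - c u\<close> equals the square norm of
  \<open>f\<close> minus \<open>c\<^sup>2\<close>, and it is nonnegative.\<close>

lemma l2_inner_unit_le:
  assumes f: "sq_integrable vol f" and u: "sq_integrable vol u" "l2_inner vol u u = 1"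
  shows "(l2_inner vol f u)\<^sup>2 \<le> (l2_norm vol f)\<^sup>2"
proof -
  define c where "c = l2_inner vol f u"
  let ?g = "\<lambda>x. 1 * f x + (- c) * u x"
  have g: "sq_integrable vol ?g" by (intro sq_integrable_lincomb f u)
  have "0 \<le> l2_inner vol ?g ?g" by (rule l2_inner_self_nonneg)
  also have "\<dots> = l2_inner vol ?g f - c * l2_inner vol ?g u"
    using l2_inner_lincomb_left[OF f u(1) g, of 1 "-c"] by (simp add: l2_inner_commute)
  also have "l2_inner vol ?g f = l2_inner vol f f - c * c"
    using l2_inner_lincomb_left[OF f u(1) f, of 1 "-c"] by (simp add: c_def l2_inner_commute)
  also have "l2_inner vol ?g u = 0"
    using l2_inner_lincomb_left[OF f u(1) u(1), of 1 "-c"] u(2) by (simp add: c_def)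
  finally show ?thesis by (simp add: l2_norm_power2 c_def power2_eq_square[symmetric])
qed

section \<open>Calculus of null double sequences, for Cauchy conditions\<close>

definition double_null :: "(nat \<Rightarrow> nat \<Rightarrow> real) \<Rightarrow> bool" where
  "double_null A \<longleftrightarrow> (\<forall>\<epsilon>>0. \<exists>N. \<forall>m\<ge>N. \<forall>k\<ge>N. A m k < \<epsilon>)"

text \<open>Holds for signed arrays because \<open>double_null\<close> bounds from above only, as
  the Cauchy condition in \<open>h1_space\<close> does. Very negative entries therefore count as
  null.\<close>

lemma double_null_mono:
  assumes "double_null A" "\<And>m k. B m k \<le> A m k"
  shows "double_null B"
  using assms unfolding double_null_def by (meson le_less_trans)

lemma double_null_add:
  assumes "double_null A" "double_null B"
  shows "double_null (\<lambda>m k. A m k + B m k)"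
  unfolding double_null_def
proof (intro allI impI)
  fix \<epsilon> :: real assume "\<epsilon> > 0"
  then obtain N1 N2 where N: "\<forall>m\<ge>N1. \<forall>k\<ge>N1. A m k < \<epsilon> / 2" "\<forall>m\<ge>N2. \<forall>k\<ge>N2. B m k < \<epsilon> / 2"
    using assms half_gt_zero[OF \<open>\<epsilon> > 0\<close>] unfolding double_null_def by blast
  have "A m k + B m k < \<epsilon>" if "m \<ge> max N1 N2" "k \<ge> max N1 N2" for m k
  proof -
    have "A m k < \<epsilon> / 2" "B m k < \<epsilon> / 2" using N that by auto
    then show ?thesis by simp
  qed
  then show "\<exists>N. \<forall>m\<ge>N. \<forall>k\<ge>N. A m k + B m k < \<epsilon>" by blast
qed

lemma double_null_cmult:
  assumes "double_null A" "0 \<le> c"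
  shows "double_null (\<lambda>m k. c * A m k)"
proof (cases "c = 0")
  case False
  with assms(2) have "c > 0" by simp
  show ?thesis unfolding double_null_def
  proof (intro allI impI)
    fix \<epsilon> :: real assume "\<epsilon> > 0"
    then have "\<epsilon> / c > 0" using \<open>c > 0\<close> by simp
    then obtain N where "\<forall>m\<ge>N. \<forall>k\<ge>N. A m k < \<epsilon> / c"
      using assms unfolding double_null_def by meson
    then show "\<exists>N. \<forall>m\<ge>N. \<forall>k\<ge>N. c * A m k < \<epsilon>"
      using \<open>c > 0\<close> by (auto simp: field_simps)
  qed
qed (simp add: double_null_def)

lemma double_null_sum:
  assumes "finite J" "\<And>j. j \<in> J \<Longrightarrow> double_null (A j)"
  shows "double_null (\<lambda>m k. \<Sum>j\<in>J. A j m k)"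
  using assms by (induction J) (auto simp: double_null_add, simp add: double_null_def)

lemma double_null_tendsto:
  assumes "X \<longlonglongrightarrow> 0"
  shows "double_null (\<lambda>m k. X m)" "double_null (\<lambda>m k. X k)"
proof -
  have "\<exists>N. \<forall>m\<ge>N. X m < \<epsilon>" if "\<epsilon> > 0" for \<epsilon>
    using order_tendstoD(2)[OF assms that] by (simp add: eventually_sequentially)
  then show "double_null (\<lambda>m k. X m)" "double_null (\<lambda>m k. X k)"
    unfolding double_null_def by blast+
qed

text \<open>Negative entries are covered too: \<open>sqrt\<close> is odd and strictly increasing on
  all reals, so \<open>sqrt x < \<epsilon>\<close> amounts to \<open>x < \<epsilon>\<^sup>2\<close>
  for positive \<open>\<epsilon>\<close>.\<close>

lemma double_null_sqrt_iff: "double_null (\<lambda>m k. sqrt (A m k)) \<longleftrightarrow> double_null A"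
proof
  have *: "sqrt x < \<epsilon> \<longleftrightarrow> x < \<epsilon>\<^sup>2" if "\<epsilon> > 0" for x \<epsilon> :: real
    using that real_sqrt_less_iff[of x "\<epsilon>\<^sup>2"] by simp
  { assume R: "double_null A"
    show "double_null (\<lambda>m k. sqrt (A m k))" unfolding double_null_def
    proof (intro allI impI)
      fix \<epsilon> :: real assume "\<epsilon> > 0"
      then show "\<exists>N. \<forall>m\<ge>N. \<forall>k\<ge>N. sqrt (A m k) < \<epsilon>"
        using R[unfolded double_null_def, rule_format, of "\<epsilon>\<^sup>2"] by (simp add: *)
    qed }
  { assume L: "double_null (\<lambda>m k. sqrt (A m k))"
    show "double_null A" unfolding double_null_def
    proof (intro allI impI)
      fix \<epsilon> :: real assume "\<epsilon> > 0"
      then show "\<exists>N. \<forall>m\<ge>N. \<forall>k\<ge>N. A m k < \<epsilon>"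
        using L[unfolded double_null_def, rule_format, of "sqrt \<epsilon>"] by simp
    qed }
qed

section \<open>Energy forms on the span of an orthonormal sequence and linearity of the energy
  space\<close>

locale l2_orthonormal =
  fixes vol :: "'a measure" and e :: "nat \<Rightarrow> 'a \<Rightarrow> real"
  assumes sq: "sq_integrable vol (e k)"
    and orth: "l2_inner vol (e k) (e l) = (if k = l then 1 else 0)"
begin

lemma eigen_span_sq_integrable: "f \<in> eigen_span e \<Longrightarrow> sq_integrable vol f"
  by (auto simp: eigen_span_def intro!: sq_integrable_sum sq)

lemma eigen_span_lincomb:
  assumes "f \<in> eigen_span e" "h \<in> eigen_span e"
  shows "(\<lambda>x. a * f x + b * h x) \<in> eigen_span e"
proof -
  \<comment> \<open>Padding with zero coefficients brings both combinations to a common length,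
    after which they are added coefficientwise.\<close>
  have ext: "\<exists>c. f = (\<lambda>x. \<Sum>k<max N N'. c k * e k x)" if "f = (\<lambda>x. \<Sum>k<N. d k * e k x)" for f N N' d
  proof -
    have "(\<Sum>k<max N N'. (if k < N then d k else 0) * e k x) = (\<Sum>k<N. d k * e k x)" for x
      by (rule sum.mono_neutral_cong_right) auto
    then show ?thesis using that by (intro exI[of _ "\<lambda>k. if k < N then d k else 0"]) simp
  qed
  obtain N d N' d' where fh: "f = (\<lambda>x. \<Sum>k<N. d k * e k x)" "h = (\<lambda>x. \<Sum>k<N'. d' k * e k x)"
    using assms unfolding eigen_span_def by blast
  then obtain c c' where "f = (\<lambda>x. \<Sum>k<max N N'. c k * e k x)" "h = (\<lambda>x. \<Sum>k<max N N'. c' k * e k x)"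
    using ext[OF fh(1), where N' = N'] ext[OF fh(2), where N' = N] by (auto simp: max.commute)
  then show ?thesis unfolding eigen_span_def
    by (intro CollectI exI[of _ "max N N'"] exI[of _ "\<lambda>k. a * c k + b * c' k"])
      (simp add: distrib_right sum.distrib sum_distrib_left mult.assoc)
qed

lemma eigen_span_diff:
  "f \<in> eigen_span e \<Longrightarrow> h \<in> eigen_span e \<Longrightarrow> (\<lambda>x. f x - h x) \<in> eigen_span e"
  using eigen_span_lincomb[of f h 1 "-1"] by simp

lemma eigen_span_coeffs_finite:
  assumes "f \<in> eigen_span e"
  shows "\<exists>N. \<forall>k\<ge>N. l2_inner vol f (e k) = 0"
proof -
  obtain N d where "f = (\<lambda>x. \<Sum>k<N. d k * e k x)"
    using assms unfolding eigen_span_def by blast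
  then show ?thesis
    by (intro exI[of _ N]) (auto simp: l2_inner_sum_left sq orth intro!: sum.neutral)
qed

text \<open>Merges the two sums in \<open>h1_norm\<close> into one weighted series: the first block
  carries weight 1, the rest the eigenvalues.\<close>

definition weight :: "(nat \<Rightarrow> real) \<Rightarrow> nat \<Rightarrow> real" where
  "weight lam k = (if k < card {k. lam k = 0} then 1 else lam k)"

text \<open>The weights are a parameter because the form is also evaluated with the absolute values
  of the weights.\<close>

definition energy :: "(nat \<Rightarrow> real) \<Rightarrow> ('a \<Rightarrow> real) \<Rightarrow> real" where
  "energy w f = (\<Sum>k. w k * (l2_inner vol f (e k))\<^sup>2)"

lemma energy_eq_sum:
  assumes "\<forall>k\<ge>N. l2_inner vol f (e k) = 0"
  shows "energy w f = (\<Sum>k<N. w k * (l2_inner vol f (e k))\<^sup>2)"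
  unfolding energy_def using assms by (intro suminf_finite) auto

text \<open>On the span only finitely many coefficients are nonzero, so the weighted series is
  summable and may be split after its first \<open>m\<close> terms.\<close>

lemma h1_norm_eq:
  assumes "f \<in> eigen_span e"
  shows "h1_norm vol lam e f = sqrt (energy (weight lam) f)"
proof -
  obtain N where N: "\<forall>k\<ge>N. l2_inner vol f (e k) = 0"
    using eigen_span_coeffs_finite[OF assms] by blast
  define m where "m = card {k. lam k = 0}"
  define g where "g k = weight lam k * (l2_inner vol f (e k))\<^sup>2" for k
  have "summable g"
    unfolding g_def using N by (intro summable_finite[of "{..<N}"]) auto
  then have "(\<Sum>k. g k) = (\<Sum>k. g (k + m)) + (\<Sum>k<m. g k)"
    by (rule suminf_split_initial_segment)
  then have "energy (weight lam) f = (\<Sum>k<m. (l2_inner vol f (e k))\<^sup>2)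
      + (\<Sum>k. lam (m + k) * (l2_inner vol f (e (m + k)))\<^sup>2)"
    unfolding energy_def g_def weight_def m_def by (simp add: add.commute)
  then show ?thesis by (simp add: h1_norm_def m_def Let_def)
qed

text \<open>Two weight families allow signed weights on the left: the estimate passes through
  \<open>v k \<le> w k\<close> on squares, and convexity of the square is then used with nonnegative
  \<open>w k\<close>. The application takes for \<open>w\<close> the absolute value of
  \<open>v\<close>.\<close>

lemma energy_lincomb_le:
  assumes "f \<in> eigen_span e" "h \<in> eigen_span e" "\<And>k. v k \<le> w k" "\<And>k. 0 \<le> w k"
  shows "energy v (\<lambda>x. a * f x + b * h x) \<le> 2 * a\<^sup>2 * energy w f + 2 * b\<^sup>2 * energy w h"
proof -
  obtain N1 N2 where "\<forall>k\<ge>N1. l2_inner vol f (e k) = 0" "\<forall>k\<ge>N2. l2_inner vol h (e k) = 0"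
    using eigen_span_coeffs_finite assms(1,2) by meson
  then have N: "\<forall>k\<ge>max N1 N2. l2_inner vol f (e k) = 0" "\<forall>k\<ge>max N1 N2. l2_inner vol h (e k) = 0"
    by auto
  let ?N = "max N1 N2"
  have c: "l2_inner vol (\<lambda>x. a * f x + b * h x) (e k) = a * l2_inner vol f (e k) + b * l2_inner vol h (e k)" for k
    using assms(1,2) by (intro l2_inner_lincomb_left eigen_span_sq_integrable sq)
  have "v k * (a * x + b * y)\<^sup>2 \<le> w k * (2 * a\<^sup>2 * x\<^sup>2 + 2 * b\<^sup>2 * y\<^sup>2)" for k x y
    by (rule order_trans[OF mult_right_mono[OF assms(3)] mult_left_mono[OF square_lincomb_le assms(4)]]) simp
  then have "energy v (\<lambda>x. a * f x + b * h x) \<le>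
      (\<Sum>k<?N. w k * (2 * a\<^sup>2 * (l2_inner vol f (e k))\<^sup>2 + 2 * b\<^sup>2 * (l2_inner vol h (e k))\<^sup>2))"
    using N by (subst energy_eq_sum[of ?N]) (auto simp: c intro!: sum_mono)
  also have "\<dots> = 2 * a\<^sup>2 * energy w f + 2 * b\<^sup>2 * energy w h"
    by (simp add: energy_eq_sum[OF N(1)] energy_eq_sum[OF N(2)] sum_distrib_left sum.distrib[symmetric] algebra_simps)
  finally show ?thesis .
qed

text \<open>L2 convergence alone makes each fixed coefficient Cauchy: write \<open>F m - F k\<close>
  as the difference of \<open>F m - f\<close> and \<open>F k - f\<close> and apply Bessel's
  inequality. This is what controls finitely many negative weights below.\<close>

lemma double_null_coeff:
  assumes f: "sq_integrable vol f" and F: "\<And>m. F m \<in> eigen_span e"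
    and lim: "(\<lambda>m. l2_norm vol (\<lambda>x. F m x - f x)) \<longlonglongrightarrow> 0"
  shows "double_null (\<lambda>m k. (l2_inner vol (\<lambda>x. F m x - F k x) (e j))\<^sup>2)"
proof -
  define X where "X m = 2 * (l2_norm vol (\<lambda>x. F m x - f x))\<^sup>2" for m
  have X: "X \<longlonglongrightarrow> 0" unfolding X_def using tendsto_mult[OF tendsto_const[of 2] tendsto_power[OF lim, of 2]] by simp
  have Fs: "sq_integrable vol (F m)" for m using F by (rule eigen_span_sq_integrable)
  have "(l2_inner vol (\<lambda>x. F m x - F k x) (e j))\<^sup>2 \<le> X m + X k" for m k
  proof -
    have "(l2_inner vol (\<lambda>x. F m x - F k x) (e j))\<^sup>2 \<le> (l2_norm vol (\<lambda>x. F m x - F k x))\<^sup>2"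
      using sq orth by (intro l2_inner_unit_le sq_integrable_diff Fs) auto
    also have "\<dots> \<le> X m + X k"
      using l2_norm_lincomb_le[OF sq_integrable_diff[OF Fs f] sq_integrable_diff[OF Fs f], of 1 m "-1" k]
      by (simp add: X_def)
    finally show ?thesis .
  qed
  then show ?thesis
    by (rule double_null_mono[OF double_null_add[OF double_null_tendsto[OF X]]])
qed

lemma h1_space_iff:
  "f \<in> h1_space vol lam e \<longleftrightarrow> sq_integrable vol f \<and>
     (\<exists>F. (\<forall>m. F m \<in> eigen_span e) \<and>
          double_null (\<lambda>m k. energy (weight lam) (\<lambda>x. F m x - F k x)) \<and>
          (\<lambda>m. l2_norm vol (\<lambda>x. F m x - f x)) \<longlonglongrightarrow> 0)"
proof -
  have "(\<forall>\<epsilon>>0. \<exists>N. \<forall>m\<ge>N. \<forall>k\<ge>N. h1_norm vol lam e (\<lambda>x. F m x - F k x) < \<epsilon>) \<longleftrightarrow>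
      double_null (\<lambda>m k. energy (weight lam) (\<lambda>x. F m x - F k x))" (is "?L F \<longleftrightarrow> ?R F")
    if "\<forall>m. F m \<in> eigen_span e" for F
    using that h1_norm_eq[OF eigen_span_diff]
    by (subst double_null_sqrt_iff[symmetric]) (simp add: double_null_def)
  then have eq: "(\<forall>m. F m \<in> eigen_span e) \<and> ?L F \<and> X F \<longleftrightarrow> (\<forall>m. F m \<in> eigen_span e) \<and> ?R F \<and> X F" for F X
    by blast
  show ?thesis unfolding h1_space_def mem_Collect_eq
    by (rule conj_cong[OF refl], rule ex_cong1, rule eq)
qed

text \<open>No sign of the eigenvalues is available without integration by parts on the manifold, so
  negative weights are not excluded. If there are only finitely many of them, their
  contribution to the energy is controlled by \<open>L\<^sup>2\<close> convergence; otherwise all eigenvalues are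
  negative and the Cauchy condition is void.\<close>

lemma h1_space_lincomb:
  assumes mono: "mono lam" and f: "f \<in> h1_space vol lam e" and h: "h \<in> h1_space vol lam e"
  shows "(\<lambda>x. a * f x + b * h x) \<in> h1_space vol lam e"
proof -
  let ?w = "weight lam" and ?w' = "\<lambda>k. \<bar>weight lam k\<bar>"
  obtain F where F: "\<And>m. F m \<in> eigen_span e" "double_null (\<lambda>m k. energy ?w (\<lambda>x. F m x - F k x))"
    "(\<lambda>m. l2_norm vol (\<lambda>x. F m x - f x)) \<longlonglongrightarrow> 0" and fs: "sq_integrable vol f"
    using f unfolding h1_space_iff by blast
  obtain H where H: "\<And>m. H m \<in> eigen_span e" "double_null (\<lambda>m k. energy ?w (\<lambda>x. H m x - H k x))"
    "(\<lambda>m. l2_norm vol (\<lambda>x. H m x - h x)) \<longlonglongrightarrow> 0" and hs: "sq_integrable vol h"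
    using h unfolding h1_space_iff by blast
  define G where "G m = (\<lambda>x. a * F m x + b * H m x)" for m
  have G: "G m \<in> eigen_span e" for m
    unfolding G_def by (intro eigen_span_lincomb F H)
  \<comment> \<open>Convergence is shown for squared norms, where the quadratic bound applies, and
    then carried back by continuity of \<open>sqrt\<close>.\<close>
  have "(\<lambda>m. (l2_norm vol (\<lambda>x. G m x - (a * f x + b * h x)))\<^sup>2) \<longlonglongrightarrow> 0"
  proof (rule tendsto_sandwich[where f = "\<lambda>_. 0" and h = "\<lambda>m. 2 * a\<^sup>2 * (l2_norm vol (\<lambda>x. F m x - f x))\<^sup>2
      + 2 * b\<^sup>2 * (l2_norm vol (\<lambda>x. H m x - h x))\<^sup>2"])
    show "\<forall>\<^sub>F m in sequentially. (l2_norm vol (\<lambda>x. G m x - (a * f x + b * h x)))\<^sup>2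
        \<le> 2 * a\<^sup>2 * (l2_norm vol (\<lambda>x. F m x - f x))\<^sup>2 + 2 * b\<^sup>2 * (l2_norm vol (\<lambda>x. H m x - h x))\<^sup>2"
    proof (rule always_eventually, rule allI)
      fix m
      have "(\<lambda>x. G m x - (a * f x + b * h x)) = (\<lambda>x. a * (F m x - f x) + b * (H m x - h x))"
        by (auto simp: G_def algebra_simps)
      then show "(l2_norm vol (\<lambda>x. G m x - (a * f x + b * h x)))\<^sup>2
        \<le> 2 * a\<^sup>2 * (l2_norm vol (\<lambda>x. F m x - f x))\<^sup>2 + 2 * b\<^sup>2 * (l2_norm vol (\<lambda>x. H m x - h x))\<^sup>2"
        using l2_norm_lincomb_le[OF sq_integrable_diff[OF eigen_span_sq_integrable[OF F(1)] fs]
          sq_integrable_diff[OF eigen_span_sq_integrable[OF H(1)] hs], of a m b m] by simp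
    qed
    show "(\<lambda>m. 2 * a\<^sup>2 * (l2_norm vol (\<lambda>x. F m x - f x))\<^sup>2 + 2 * b\<^sup>2 * (l2_norm vol (\<lambda>x. H m x - h x))\<^sup>2) \<longlonglongrightarrow> 0"
      by (rule tendsto_eq_intros F(3) H(3) refl)+ simp
  qed auto
  then have lim: "(\<lambda>m. l2_norm vol (\<lambda>x. G m x - (a * f x + b * h x))) \<longlonglongrightarrow> 0"
    using tendsto_real_sqrt by (fastforce simp: l2_norm_def l2_inner_self_nonneg)
  have "double_null (\<lambda>m k. energy ?w (\<lambda>x. G m x - G k x))"
  proof (cases "\<exists>K. 0 \<le> lam K")
    case True
    then obtain K where K: "0 \<le> lam K" by blast
    have w: "0 \<le> ?w k" if "K \<le> k" for k
      using monoD[OF mono that] K by (auto simp: weight_def)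
    \<comment> \<open>Passing to absolute weights changes the energy only through the first
      \<open>K\<close> coefficients, since \<open>?w' j = ?w j\<close> from \<open>K\<close> on.
      That correction is null by \<open>double_null_coeff\<close>, and its factors
      \<open>?w' j - ?w j\<close> are nonnegative.\<close>
    have pos: "double_null (\<lambda>m k. energy ?w' (\<lambda>x. F m x - F k x))"
      if F: "\<And>m. F m \<in> eigen_span e" "double_null (\<lambda>m k. energy ?w (\<lambda>x. F m x - F k x))"
        and f: "sq_integrable vol f" "(\<lambda>m. l2_norm vol (\<lambda>x. F m x - f x)) \<longlonglongrightarrow> 0" for F f
    proof -
      have "energy ?w' (\<lambda>x. F m x - F k x) = energy ?w (\<lambda>x. F m x - F k x) +
          (\<Sum>j<K. (?w' j - ?w j) * (l2_inner vol (\<lambda>x. F m x - F k x) (e j))\<^sup>2)" for m k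
      proof -
        let ?g = "\<lambda>x. F m x - F k x"
        obtain N0 where "\<forall>k\<ge>N0. l2_inner vol ?g (e k) = 0"
          using eigen_span_coeffs_finite[OF eigen_span_diff[OF F(1) F(1)]] by blast
        \<comment> \<open>Taking \<open>N\<close> at least \<open>K\<close> ensures that the sum
          below \<open>N\<close> contains every index where the two weights may differ.\<close>
        then obtain N where N: "\<forall>k\<ge>N. l2_inner vol ?g (e k) = 0" "K \<le> N"
          by (intro that[of "max N0 K"]) auto
        have "energy ?w' ?g - energy ?w ?g = (\<Sum>j<N. (?w' j - ?w j) * (l2_inner vol ?g (e j))\<^sup>2)"
          by (simp add: energy_eq_sum[OF N(1)] sum_subtractf[symmetric] left_diff_distrib)
        also have "\<dots> = (\<Sum>j<K. (?w' j - ?w j) * (l2_inner vol ?g (e j))\<^sup>2)"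
          using N(2) w by (intro sum.mono_neutral_right) auto
        finally show ?thesis by simp
      qed
      moreover have "double_null (\<lambda>m k. energy ?w (\<lambda>x. F m x - F k x) +
          (\<Sum>j<K. (?w' j - ?w j) * (l2_inner vol (\<lambda>x. F m x - F k x) (e j))\<^sup>2))"
        by (intro double_null_add F double_null_sum double_null_cmult double_null_coeff[OF f(1) F(1) f(2)]) auto
      ultimately show ?thesis by simp
    qed
    have "double_null (\<lambda>m k. 2 * a\<^sup>2 * energy ?w' (\<lambda>x. F m x - F k x)
        + 2 * b\<^sup>2 * energy ?w' (\<lambda>x. H m x - H k x))"
      by (intro double_null_add double_null_cmult pos[OF F(1,2) fs F(3)] pos[OF H(1,2) hs H(3)]) auto
    then show ?thesis
    proof (rule double_null_mono)
      fix m k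
      have "(\<lambda>x. G m x - G k x) = (\<lambda>x. a * (F m x - F k x) + b * (H m x - H k x))"
        by (auto simp: G_def algebra_simps)
      then show "energy ?w (\<lambda>x. G m x - G k x) \<le> 2 * a\<^sup>2 * energy ?w' (\<lambda>x. F m x - F k x)
        + 2 * b\<^sup>2 * energy ?w' (\<lambda>x. H m x - H k x)"
        using energy_lincomb_le[OF eigen_span_diff[OF F(1) F(1)] eigen_span_diff[OF H(1) H(1)], of ?w ?w' a m k b m k]
        by simp
    qed
  next
    case False
    \<comment> \<open>With no zero eigenvalue the initial block of \<open>weight\<close> is empty,
      so every weight is a negative eigenvalue and every energy is at most 0.\<close>
    then have "{k. lam k = 0} = {}" by (auto simp: not_le less_imp_neq)
    then have w: "?w k \<le> 0" for k using False by (simp add: weight_def not_le less_imp_le)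
    have "energy ?w (\<lambda>x. G m x - G k x) \<le> 0" for m k
    proof -
      obtain N where "\<forall>j\<ge>N. l2_inner vol (\<lambda>x. G m x - G k x) (e j) = 0"
        using eigen_span_coeffs_finite[OF eigen_span_diff[OF G G]] by blast
      from energy_eq_sum[OF this] w show ?thesis by (auto intro!: sum_nonpos mult_nonpos_nonneg)
    qed
    then show ?thesis unfolding double_null_def by (meson le_less_trans)
  qed
  with G lim show ?thesis
    unfolding h1_space_iff using sq_integrable_lincomb[OF fs hs] by blast
qed

end

section \<open>Inner products of vector fields\<close>

lemma smooth_on_imp_continuous_on:
  assumes "smooth_on S f"
  shows "continuous_on S f"
  unfolding continuous_on_def
proof
  fix x assume "x \<in> S"
  then obtain T g where T: "open T" "x \<in> T" "\<forall>k. Ck_on k T g" "\<forall>y\<in>S \<inter> T. g y = f y"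
    using assms unfolding smooth_on_def by blast
  from T(3) have "continuous_on T g" by (metis Ck_on.simps(1))
  then have "(g \<longlongrightarrow> f x) (at x within T \<inter> S)"
    using T(2,4) \<open>x \<in> S\<close> by (metis IntI continuous_on_def inf_le1 tendsto_within_subset)
  then have "(f \<longlongrightarrow> f x) (at x within T \<inter> S)"
    by (rule Lim_transform_eventually) (use T(4) in \<open>auto simp: eventually_at_filter\<close>)
  moreover have "at x within S = at x within T \<inter> S"
    by (rule at_within_nhd[OF T(2,1)]) auto
  ultimately show "(f \<longlongrightarrow> f x) (at x within S)" by simp
qed

lemma inner_matrix_vector_mult: "x \<bullet> (A *v y) = (transpose A *v x) \<bullet> y" for A :: "real ^ 'n ^ 'm"
  by (simp add: dot_lmul_matrix transpose_matrix_vector)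

context
  fixes M :: "('a, 'd::finite) riem" and vol :: "'a measure"
  assumes M: "compact_riemannian_manifold M" and vol: "riemannian_volume M vol"
begin

lemma chart_at:
  assumes "p \<in> space vol" obtains c where "c \<in> charts M" "p \<in> fst c"
proof -
  have "p \<in> \<Union> (fst ` charts M)"
    using assms M vol
    unfolding compact_riemannian_manifold_def oriented_atlas_def riemannian_volume_def by simp
  then show ?thesis using that by blast
qed

lemma openin_imp_sets: "openin (pts M) U \<Longrightarrow> U \<in> sets vol"
  using vol unfolding riemannian_volume_def by auto

lemma chart_openin: "c \<in> charts M \<Longrightarrow> openin (pts M) (fst c)"
  using M unfolding compact_riemannian_manifold_def oriented_atlas_def by auto

lemma chart_sets: "c \<in> charts M \<Longrightarrow> fst c \<in> sets vol"
  using chart_openin openin_imp_sets by blast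

lemma metric_transpose: "c \<in> charts M \<Longrightarrow> p \<in> fst c \<Longrightarrow> transpose (metric M c p) = metric M c p"
  using M unfolding compact_riemannian_manifold_def riemannian_metric_def by blast

lemma metric_nonneg:
  assumes "c \<in> charts M" "p \<in> fst c"
  shows "0 \<le> x \<bullet> (metric M c p *v x)"
proof (cases "x = 0")
  case False
  then have "0 < x \<bullet> (metric M c p *v x)"
    using M assms unfolding compact_riemannian_manifold_def riemannian_metric_def by blast
  then show ?thesis by simp
qed simp

text \<open>Frees \<open>metric_inner\<close> from its arbitrary choice of chart: fields transform
  by the Jacobian \<open>J\<close>, and the metric by \<open>J\<close> on both sides, so the two
  changes cancel.\<close>

lemma metric_inner_eq:
  assumes "vector_field M X" "vector_field M Y" "c \<in> charts M" "p \<in> fst c"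
  shows "metric_inner M p X Y = X c p \<bullet> (metric M c p *v Y c p)"
proof -
  define c' where "c' = (SOME c. c \<in> charts M \<and> p \<in> fst c)"
  have c': "c' \<in> charts M" "p \<in> fst c'"
    using someI[of "\<lambda>c. c \<in> charts M \<and> p \<in> fst c" c] assms(3,4) by (auto simp: c'_def)
  define J where "J = transition_jacobian c c' p"
  have X: "X c' p = J *v X c p" and Y: "Y c' p = J *v Y c p"
    using assms c' unfolding vector_field_def J_def by blast+
  have "metric M c p = transpose J ** metric M c' p ** J"
    using M assms c' unfolding compact_riemannian_manifold_def riemannian_metric_def J_def by blast
  then show ?thesis
    unfolding metric_inner_def Let_def c'_def[symmetric] X Y
    by (simp only: matrix_vector_mul_assoc[symmetric] inner_matrix_vector_mult[of _ "transpose J"] transpose_transpose)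
qed

lemma metric_inner_self_nonneg:
  assumes "vector_field M X" "p \<in> space vol"
  shows "0 \<le> metric_inner M p X X"
proof -
  obtain c where c: "c \<in> charts M" "p \<in> fst c" using chart_at[OF assms(2)] .
  then show ?thesis by (simp add: metric_inner_eq[OF assms(1,1) c] metric_nonneg)
qed

text \<open>On a chart domain the metric is its smooth coordinate expression composed with the
  chart, hence continuous. As the domain is open, preimages of open sets are open in the manifold
  and so belong to \<open>sets vol\<close>.\<close>

lemma metric_measurable:
  assumes c: "c \<in> charts M"
  shows "metric M c \<in> borel_measurable (restrict_space vol (fst c))"
proof -
  define \<phi> where "\<phi> = snd c"
  have h: "homeomorphic_map (subtopology (pts M) (fst c)) (top_of_set (\<phi> ` fst c)) \<phi>"
    and s: "smooth_on (\<phi> ` fst c) (metric M c \<circ> chart_inv c)"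
    using M c unfolding compact_riemannian_manifold_def oriented_atlas_def riemannian_metric_def \<phi>_def by auto
  have top: "topspace (subtopology (pts M) (fst c)) = fst c"
    using chart_openin[OF c] openin_subset by (fastforce simp: topspace_subtopology)
  have inj: "inj_on \<phi> (fst c)"
    using homeomorphic_imp_injective_map[OF h] by (simp only: top)
  have "continuous_map (top_of_set (\<phi> ` fst c)) euclidean (metric M c \<circ> chart_inv c)"
    using smooth_on_imp_continuous_on[OF s] by simp
  then have "continuous_map (subtopology (pts M) (fst c)) euclidean ((metric M c \<circ> chart_inv c) \<circ> \<phi>)"
    using continuous_map_compose homeomorphic_imp_continuous_map[OF h] by blast
  then have cont: "continuous_map (subtopology (pts M) (fst c)) euclidean (metric M c)"
    by (rule continuous_map_eq) (use inj in \<open>auto simp: top \<phi>_def[symmetric]\<close>)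
  show ?thesis
  proof (rule borel_measurableI)
    fix U :: "(real ^ 'd ^ 'd) set" assume "open U"
    then have "openin (subtopology (pts M) (fst c)) {x \<in> fst c. metric M c x \<in> U}"
      using openin_continuous_map_preimage[OF cont] by (simp only: open_openin top)
    then have "openin (pts M) {x \<in> fst c. metric M c x \<in> U}"
      using chart_openin[OF c] openin_trans_full by blast
    moreover have "{x \<in> fst c. metric M c x \<in> U} = metric M c -` U \<inter> space (restrict_space vol (fst c))"
      using sets.sets_into_space[OF chart_sets[OF c]] by (auto simp: space_restrict_space)
    ultimately show "metric M c -` U \<inter> space (restrict_space vol (fst c)) \<in> sets (restrict_space vol (fst c))"
      using openin_imp_sets chart_sets[OF c]
      by (metis (no_types, lifting) Int_iff mem_Collect_eq sets_restrict_space_iff sets.Int_space_eq2 subsetI)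
  qed
qed

text \<open>The atlas may be uncountable, so compactness is used to select finitely many chart
  domains covering the manifold. On each of them the inner product is a polynomial in measurable
  components.\<close>

lemma metric_inner_measurable:
  assumes "sq_integrable_field M vol X" "sq_integrable_field M vol Y"
  shows "(\<lambda>p. metric_inner M p X Y) \<in> borel_measurable vol"
proof -
  have "\<Union> (fst ` charts M) = topspace (pts M)" "compact_space (pts M)"
    using M unfolding compact_riemannian_manifold_def oriented_atlas_def by auto
  then obtain F where F: "finite F" "F \<subseteq> fst ` charts M" "\<Union> F = topspace (pts M)"
    using chart_openin unfolding compact_space by (metis (no_types, lifting) imageE)
  show ?thesis
  proof (rule measurable_piecewise_restrict[of F])
    show "countable F" using F(1) by (rule countable_finite)
    show "space vol \<subseteq> \<Union> F" using F(3) vol unfolding riemannian_volume_def by simp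
    fix \<Omega> assume "\<Omega> \<in> F"
    then obtain c where c: "c \<in> charts M" "\<Omega> = fst c" using F(2) by auto
    show "\<Omega> \<inter> space vol \<in> sets vol" using chart_sets[OF c(1)] c(2) by auto
    have [measurable]: "X c \<in> borel_measurable (restrict_space vol \<Omega>)"
      "Y c \<in> borel_measurable (restrict_space vol \<Omega>)"
      using assms c unfolding sq_integrable_field_def by auto
    have [measurable]: "metric M c \<in> borel_measurable (restrict_space vol \<Omega>)"
      using metric_measurable c by simp
    have nth: "(\<lambda>p. f p $ i) \<in> borel_measurable N" if "f \<in> borel_measurable N"
      for f :: "'a \<Rightarrow> 'v::second_countable_topology ^ 'd" and i N
    proof -
      have "continuous_on UNIV (\<lambda>x :: 'v ^ 'd. x $ i)"
        by (intro continuous_on_component continuous_on_id)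
      then show ?thesis
        using measurable_compose[OF that borel_measurable_continuous_onI] by blast
    qed
    have "(\<lambda>p. \<Sum>i\<in>UNIV. X c p $ i * (\<Sum>j\<in>UNIV. metric M c p $ i $ j * Y c p $ j))
        \<in> borel_measurable (restrict_space vol \<Omega>)"
      by (intro borel_measurable_sum borel_measurable_times nth) measurable
    then have "(\<lambda>p. X c p \<bullet> (metric M c p *v Y c p)) \<in> borel_measurable (restrict_space vol \<Omega>)"
      by (simp add: inner_vec_def matrix_vector_mult_def)
    then show "(\<lambda>p. metric_inner M p X Y) \<in> borel_measurable (restrict_space vol \<Omega>)"
      by (rule measurable_cong[THEN iffD1, rotated])
        (use assms c in \<open>auto simp: space_restrict_space sq_integrable_field_def intro!: metric_inner_eq[symmetric]\<close>)
  qed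
qed

lemma metric_inner_commute:
  assumes "vector_field M X" "vector_field M Y" "p \<in> space vol"
  shows "metric_inner M p X Y = metric_inner M p Y X"
proof -
  obtain c where c: "c \<in> charts M" "p \<in> fst c" using chart_at[OF assms(3)] .
  have "X c p \<bullet> (metric M c p *v Y c p) = Y c p \<bullet> (metric M c p *v X c p)"
    using inner_matrix_vector_mult[of "X c p" "metric M c p" "Y c p"]
    by (simp only: metric_transpose[OF c] inner_commute)
  then show ?thesis
    by (simp add: metric_inner_eq[OF _ _ c] assms(1,2))
qed

lemma metric_inner_integrable:
  assumes X: "sq_integrable_field M vol X" and Y: "sq_integrable_field M vol Y"
  shows "integrable vol (\<lambda>p. metric_inner M p X Y)"
proof (rule Bochner_Integration.integrable_bound)
  have vf: "vector_field M X" "vector_field M Y"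
    using X Y unfolding sq_integrable_field_def by auto
  show "integrable vol (\<lambda>p. metric_inner M p X X + metric_inner M p Y Y)"
    using X Y unfolding sq_integrable_field_def by auto
  show "(\<lambda>p. metric_inner M p X Y) \<in> borel_measurable vol"
    using metric_inner_measurable[OF X Y] .
  have "\<bar>metric_inner M p X Y\<bar> \<le> metric_inner M p X X + metric_inner M p Y Y" if p: "p \<in> space vol" for p
  proof -
    obtain c where c: "c \<in> charts M" "p \<in> fst c" using chart_at[OF p] .
    have eq: "metric_inner M p Z Z' = Z c p \<bullet> (metric M c p *v Z' c p)"
      if "vector_field M Z" "vector_field M Z'" for Z Z' using that c by (rule metric_inner_eq)
    note pos = metric_nonneg[OF c]
    have sym: "Y c p \<bullet> (metric M c p *v X c p) = X c p \<bullet> (metric M c p *v Y c p)"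
      using metric_inner_commute[OF vf p] by (simp add: eq vf)
    \<comment> \<open>Positivity of the metric on \<open>X + Y\<close> and on \<open>X - Y\<close>
      bounds the mixed term from both sides.\<close>
    have "0 \<le> metric_inner M p X X + metric_inner M p Y Y" "2 * \<bar>metric_inner M p X Y\<bar> \<le> metric_inner M p X X + metric_inner M p Y Y"
      using pos[of "X c p + Y c p"] pos[of "X c p - Y c p"] pos[of "X c p"] pos[of "Y c p"] sym
      by (auto simp: eq vf matrix_vector_right_distrib matrix_vector_mult_diff_distrib inner_simps)
    then show ?thesis by linarith
  qed
  then show "AE p in vol. norm (metric_inner M p X Y) \<le> norm (metric_inner M p X X + metric_inner M p Y Y)"
    using metric_inner_self_nonneg vf by (intro AE_I2) force
qed

lemma field_inner_commute:
  assumes "sq_integrable_field M vol X" "sq_integrable_field M vol Y"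
  shows "field_inner M vol X Y = field_inner M vol Y X"
  unfolding field_inner_def using assms
  by (intro Bochner_Integration.integral_cong refl metric_inner_commute) (auto simp: sq_integrable_field_def)

lemma field_inner_lincomb_left:
  assumes sq: "sq_integrable_field M vol X" "sq_integrable_field M vol Y"
      "sq_integrable_field M vol Z" "sq_integrable_field M vol U"
    and Z: "AE p in vol. \<forall>c\<in>charts M. p \<in> fst c \<longrightarrow> Z c p = a *\<^sub>R X c p + b *\<^sub>R Y c p"
  shows "field_inner M vol Z U = a * field_inner M vol X U + b * field_inner M vol Y U"
proof -
  have vf: "vector_field M X" "vector_field M Y" "vector_field M Z" "vector_field M U"
    using sq unfolding sq_integrable_field_def by simp_all
  have "AE p in vol. metric_inner M p Z U = a * metric_inner M p X U + b * metric_inner M p Y U"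
    using Z AE_space
  proof eventually_elim
    case (elim p)
    obtain c where c: "c \<in> charts M" "p \<in> fst c" using chart_at[OF elim(2)] .
    with elim(1) show ?case
      by (simp add: metric_inner_eq[OF _ _ c] vf inner_simps)
  qed
  then have "field_inner M vol Z U = (\<integral>p. a * metric_inner M p X U + b * metric_inner M p Y U \<partial>vol)"
    unfolding field_inner_def
    by (intro integral_cong_AE borel_measurable_add borel_measurable_times metric_inner_measurable sq) auto
  also have "\<dots> = a * field_inner M vol X U + b * field_inner M vol Y U"
    unfolding field_inner_def using metric_inner_integrable sq by simp
  finally show ?thesis .
qed

end

section \<open>The Galerkin eigenproblem in coordinates\<close>

definition lincomb :: "('n::finite \<Rightarrow> 'a \<Rightarrow> real) \<Rightarrow> real ^ 'n \<Rightarrow> 'a \<Rightarrow> real" where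
  "lincomb \<psi> a = (\<lambda>x. \<Sum>j\<in>UNIV. a $ j * \<psi> j x)"

lemma lin_span_eq_range: "lin_span \<psi> = range (lincomb \<psi>)"
proof -
  have "(\<lambda>x. \<Sum>j\<in>UNIV. a j * \<psi> j x) = lincomb \<psi> (\<chi> j. a j)" for a
    by (simp add: lincomb_def)
  then show ?thesis unfolding lin_span_def lincomb_def by fastforce
qed

lemma lincomb_sum: "lincomb \<psi> (\<Sum>k\<in>K. c k *\<^sub>R a k) = (\<lambda>x. \<Sum>k\<in>K. c k * lincomb \<psi> (a k) x)"
proof
  fix x
  have "lincomb \<psi> (\<Sum>k\<in>K. c k *\<^sub>R a k) x = (\<Sum>j\<in>UNIV. \<Sum>k\<in>K. c k * (a k $ j * \<psi> j x))"
    by (simp add: lincomb_def sum_distrib_right mult.assoc)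
  also have "\<dots> = (\<Sum>k\<in>K. c k * lincomb \<psi> (a k) x)"
    by (subst sum.swap) (simp add: lincomb_def sum_distrib_left)
  finally show "lincomb \<psi> (\<Sum>k\<in>K. c k *\<^sub>R a k) x = (\<Sum>k\<in>K. c k * lincomb \<psi> (a k) x)" .
qed

lemma lincomb_scaleR: "lincomb \<psi> (c *\<^sub>R a) = (\<lambda>x. c * lincomb \<psi> a x)"
  by (simp add: lincomb_def sum_distrib_left mult.assoc)

text \<open>Makes coordinates well defined on L2 classes. The uniqueness of the coefficient vector
  \<open>Z\<close> in the final theorem rests on this.\<close>

lemma lincomb_inj:
  assumes "l2_independent vol \<psi>" and "AE x in vol. lincomb \<psi> a x = lincomb \<psi> b x"
  shows "a = b"
proof -
  have "AE x in vol. (\<Sum>j\<in>UNIV. (a $ j - b $ j) * \<psi> j x) = 0"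
    using assms(2) by (simp add: lincomb_def left_diff_distrib sum_subtractf)
  then have "\<forall>j. a $ j - b $ j = 0"
    using assms(1)[unfolded l2_independent_def, rule_format, of "\<lambda>j. a $ j - b $ j"] by blast
  then show ?thesis by (simp add: vec_eq_iff)
qed

section \<open>Inverse, diagonal and orthogonal matrices\<close>

lemma matrix_inv:
  fixes A :: "real ^ 'n ^ 'n"
  assumes "invertible A"
  shows matrix_inv_right: "A ** matrix_inv A = mat 1" and matrix_inv_left: "matrix_inv A ** A = mat 1"
  using assms someI_ex[of "\<lambda>A'. A ** A' = mat 1 \<and> A' ** A = mat 1"]
  unfolding invertible_def matrix_inv_def by auto

lemma matrix_inv_unique:
  fixes A :: "real ^ 'n ^ 'n"
  assumes "A ** B = mat 1"
  shows "matrix_inv A = B"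
proof -
  have "invertible A" using assms by (auto simp: invertible_right_inverse)
  then have "matrix_inv A ** (A ** B) = B"
    by (simp add: matrix_mul_assoc matrix_inv_left)
  then show ?thesis by (simp add: assms)
qed

lemma matrix_inv_transpose:
  fixes A :: "real ^ 'n ^ 'n"
  assumes "invertible A"
  shows "matrix_inv (transpose A) = transpose (matrix_inv A)"
  by (rule matrix_inv_unique) (simp add: matrix_transpose_mul[symmetric] matrix_inv_left[OF assms])

lemma diag_matrix_vector: "(diag_matrix d *v x) $ i = d i * x $ i"
  by (simp add: diag_matrix_def matrix_vector_mult_def if_distrib[where f = "\<lambda>y. y * _"] cong: if_cong)

lemma matrix_mul_diag: "(A ** diag_matrix d) $ i $ j = A $ i $ j * d j"
  by (simp add: diag_matrix_def matrix_matrix_mult_def if_distrib[where f = "\<lambda>y. _ * y"] cong: if_cong)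

lemma transpose_diag_matrix: "transpose (diag_matrix d) = diag_matrix d"
  by (auto simp: transpose_def diag_matrix_def vec_eq_iff)

lemma diag_matrix_mult: "diag_matrix c ** diag_matrix d = diag_matrix (\<lambda>k. c k * d k)"
  by (simp add: vec_eq_iff matrix_mul_diag) (simp add: diag_matrix_def)

lemma matrix_mul_transpose_sum:
  "(L ** transpose K) $ i $ j = (\<Sum>k\<in>UNIV. L $ i $ k * K $ j $ k)"
  by (simp add: matrix_matrix_mult_def transpose_def)

text \<open>The square matrix \<open>Q\<close> with rows \<open>z k\<close> satisfies
  \<open>Q Q\<^sup>T = 1\<close>. In finite dimension a one-sided inverse is two-sided, and
  \<open>Q\<^sup>T Q w = w\<close> is the expansion.\<close>

lemma orthonormal_expansion:
  fixes z :: "'n::finite \<Rightarrow> real ^ 'n"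
  assumes "\<And>k l. z k \<bullet> z l = (if k = l then 1 else 0)"
  shows "(\<Sum>k\<in>UNIV. (w \<bullet> z k) *\<^sub>R z k) = w"
proof -
  define Q where "Q = (\<chi> k. z k)"
  have "Q ** transpose Q = mat 1"
    by (simp add: vec_eq_iff matrix_mul_transpose_sum Q_def mat_def assms[unfolded inner_vec_def, simplified])
  then have "transpose Q ** Q = mat 1"
    by (simp only: matrix_left_right_inverse)
  then have "transpose Q *v (Q *v w) = w"
    by (simp add: matrix_vector_mul_assoc)
  moreover have "transpose Q *v (Q *v w) = (\<Sum>k\<in>UNIV. (w \<bullet> z k) *\<^sub>R z k)"
    by (simp add: vec_eq_iff matrix_vector_mult_def transpose_def Q_def inner_vec_def mult.commute sum_component)
  ultimately show ?thesis by simp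
qed

text \<open>\<open>C\<close> and \<open>R\<close> are the Gram matrices of the mass and the energy form, \<open>A\<close> contains the
  coordinates of a simultaneous orthonormal eigenbasis.\<close>

locale galerkin_eigenproblem =
  fixes M :: "('a, 'd::finite) riem" and vol :: "'a measure" and D :: "('a \<Rightarrow> real) \<Rightarrow> ('a, 'd) field"
    and \<psi> :: "'n::finite \<Rightarrow> 'a \<Rightarrow> real" and C R A :: "real ^ 'n ^ 'n" and \<mu> :: "'n \<Rightarrow> real"
  assumes indep: "l2_independent vol \<psi>"
    and mass: "\<And>a b. l2_inner vol (lincomb \<psi> a) (lincomb \<psi> b) = a \<bullet> (C *v b)"
    and stiff: "\<And>a b. field_inner M vol (D (lincomb \<psi> a)) (D (lincomb \<psi> b)) = b \<bullet> (R *v a)"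
    and AC: "transpose A ** C ** A = mat 1"
    and AR: "transpose A ** R ** A = diag_matrix \<mu>"
begin

lemma A_invertible: "invertible A"
  using AC invertible_left_inverse by blast

lemma A_inj: "A *v x = A *v y \<longleftrightarrow> x = y"
  using matrix_inv_left[OF A_invertible]
  by (metis matrix_vector_mul_assoc matrix_vector_mul_lid)

lemma A_surj: "A *v (matrix_inv A *v y) = y"
  by (simp add: matrix_vector_mul_assoc matrix_inv_right[OF A_invertible])

lemma lincomb_A_inj: "lincomb \<psi> (A *v x) = lincomb \<psi> (A *v y) \<longleftrightarrow> x = y"
  using lincomb_inj[OF indep, of "A *v x" "A *v y"] by (auto simp: A_inj)

lemma lin_span_eq: "lin_span \<psi> = range (\<lambda>x. lincomb \<psi> (A *v x))"
proof -
  have "surj (\<lambda>x. A *v x)" using A_surj by (rule surjI)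
  then show ?thesis unfolding lin_span_eq_range by (metis image_image)
qed

lemma mass_A: "l2_inner vol (lincomb \<psi> (A *v x)) (lincomb \<psi> (A *v y)) = x \<bullet> y"
proof -
  have "l2_inner vol (lincomb \<psi> (A *v x)) (lincomb \<psi> (A *v y)) = x \<bullet> ((transpose A ** C ** A) *v y)"
    by (simp only: mass matrix_vector_mul_assoc[symmetric] inner_matrix_vector_mult[of _ "transpose A"] transpose_transpose)
  then show ?thesis by (simp add: AC)
qed

lemma stiff_A: "field_inner M vol (D (lincomb \<psi> (A *v x))) (D (lincomb \<psi> (A *v y))) = y \<bullet> (diag_matrix \<mu> *v x)"
  by (simp only: stiff AR[symmetric] matrix_vector_mul_assoc[symmetric] inner_matrix_vector_mult[of _ "transpose A"]
      transpose_transpose)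

text \<open>Testing against \<open>lincomb \<psi> (A *v z)\<close> turns the weak equation into
  \<open>z \<bullet> y = z \<bullet> (diag_matrix \<mu> *v x)\<close> for all \<open>z\<close>. This
  has exactly one solution \<open>y\<close>, as the definite description requires.\<close>

lemma discrete_neg_laplacian_A:
  "discrete_neg_laplacian M vol D \<psi> (lincomb \<psi> (A *v x)) = lincomb \<psi> (A *v (diag_matrix \<mu> *v x))"
  unfolding discrete_neg_laplacian_def
proof (rule the_equality)
  show "lincomb \<psi> (A *v (diag_matrix \<mu> *v x)) \<in> lin_span \<psi> \<and>
      (\<forall>v\<in>lin_span \<psi>. l2_inner vol (lincomb \<psi> (A *v (diag_matrix \<mu> *v x))) v =
        field_inner M vol (D (lincomb \<psi> (A *v x))) (D v))"
    by (auto simp: lin_span_eq mass_A stiff_A inner_commute)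
next
  fix w
  assume w: "w \<in> lin_span \<psi> \<and> (\<forall>v\<in>lin_span \<psi>. l2_inner vol w v = field_inner M vol (D (lincomb \<psi> (A *v x))) (D v))"
  then obtain y where y: "w = lincomb \<psi> (A *v y)" by (auto simp: lin_span_eq)
  have "z \<bullet> y = z \<bullet> (diag_matrix \<mu> *v x)" for z
  proof -
    have "lincomb \<psi> (A *v z) \<in> lin_span \<psi>" by (auto simp: lin_span_eq)
    with w have "l2_inner vol w (lincomb \<psi> (A *v z)) =
        field_inner M vol (D (lincomb \<psi> (A *v x))) (D (lincomb \<psi> (A *v z)))" by blast
    then show ?thesis by (simp add: y mass_A stiff_A inner_commute)
  qed
  then have "y = diag_matrix \<mu> *v x"
    by (subst vector_eq_ldot[symmetric]) simp
  then show "w = lincomb \<psi> (A *v (diag_matrix \<mu> *v x))"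
    by (simp only: y)
qed

lemma orthonormal_eigenbasis_A:
  "orthonormal_eigenbasis vol \<psi> (discrete_neg_laplacian M vol D \<psi>) \<mu> (\<lambda>k. lincomb \<psi> (A *v axis k 1))"
  unfolding orthonormal_eigenbasis_def
proof (intro conjI allI)
  have "lincomb (\<lambda>k. lincomb \<psi> (A *v axis k 1)) x = lincomb \<psi> (A *v x)" for x
  proof -
    have "A *v x = (\<Sum>k\<in>UNIV. (x $ k) *\<^sub>R (A *v axis k 1))"
      by (simp only: matrix_mult_sum[of A x] matrix_vector_mult_basis scalar_mult_eq_scaleR)
    then show ?thesis by (simp only: lincomb_sum) (simp only: lincomb_def)
  qed
  then show "lin_span (\<lambda>k. lincomb \<psi> (A *v axis k 1)) = lin_span \<psi>"
    by (simp add: lin_span_eq_range[of "\<lambda>k. lincomb \<psi> (A *v axis k 1)"] lin_span_eq)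
  show "l2_inner vol (lincomb \<psi> (A *v axis k 1)) (lincomb \<psi> (A *v axis l 1)) = (if k = l then 1 else 0)" for k l
    by (simp add: mass_A inner_axis_axis)
  have "diag_matrix \<mu> *v axis k 1 = \<mu> k *\<^sub>R axis k 1" for k
    by (auto simp: vec_eq_iff diag_matrix_vector axis_def)
  then show "discrete_neg_laplacian M vol D \<psi> (lincomb \<psi> (A *v axis k 1)) = (\<lambda>x. \<mu> k * lincomb \<psi> (A *v axis k 1) x)" for k
    by (simp add: discrete_neg_laplacian_A lincomb_scaleR[symmetric] matrix_vector_mult_scaleR)
qed

text \<open>The definition picks an unknown eigenbasis. In coordinates it becomes an orthonormal
  family \<open>z k\<close> of eigenvectors of \<open>diag_matrix \<mu>\<close> with eigenvalues
  \<open>\<nu> k\<close>. Applying \<open>g\<close> to the eigenvalues then gives the diagonal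
  action of \<open>g (\<mu> j)\<close>, also when eigenvalues are repeated or ordered
  differently.\<close>

lemma operator_function_A:
  "operator_function g vol \<psi> (discrete_neg_laplacian M vol D \<psi>) (lincomb \<psi> (A *v x)) =
    lincomb \<psi> (A *v (\<chi> k. g (\<mu> k) * x $ k))"
proof -
  let ?T = "discrete_neg_laplacian M vol D \<psi>"
  obtain \<nu> u where some: "(SOME (\<nu>, u). orthonormal_eigenbasis vol \<psi> ?T \<nu> u) = (\<nu>, u)"
    by (meson surj_pair)
  \<comment> \<open>The columns of \<open>A\<close> witness that an eigenbasis exists, so the chosen
    pair really is one.\<close>
  have "case (SOME (\<nu>, u). orthonormal_eigenbasis vol \<psi> ?T \<nu> u) of (\<nu>, u) \<Rightarrow> orthonormal_eigenbasis vol \<psi> ?T \<nu> u"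
    by (rule someI[of _ "(\<mu>, \<lambda>k. lincomb \<psi> (A *v axis k 1))"]) (simp add: orthonormal_eigenbasis_A)
  then have u: "orthonormal_eigenbasis vol \<psi> ?T \<nu> u" by (simp add: some)
  have "u k \<in> lin_span u" for k
    unfolding lin_span_def by (intro CollectI exI[of _ "\<lambda>j. if j = k then 1 else 0"])
      (simp add: if_distrib[where f = "\<lambda>y. y * _"] cong: if_cong)
  then have "\<exists>z. u k = lincomb \<psi> (A *v z)" for k
    using u unfolding orthonormal_eigenbasis_def lin_span_eq by blast
  then obtain z where z: "u k = lincomb \<psi> (A *v z k)" for k by metis
  have orth: "z k \<bullet> z l = (if k = l then 1 else 0)" for k l
    using u unfolding orthonormal_eigenbasis_def z mass_A by blast
  have Tz: "diag_matrix \<mu> *v z k = \<nu> k *\<^sub>R z k" for k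
  proof -
    have "?T (u k) = (\<lambda>x. \<nu> k * u k x)" using u unfolding orthonormal_eigenbasis_def by blast
    then have "lincomb \<psi> (A *v (diag_matrix \<mu> *v z k)) = lincomb \<psi> (A *v (\<nu> k *\<^sub>R z k))"
      by (simp add: z discrete_neg_laplacian_A lincomb_scaleR[symmetric] matrix_vector_mult_scaleR)
    then show ?thesis by (simp only: lincomb_A_inj)
  qed
  have eq: "\<mu> j * z k $ j = \<nu> k * z k $ j" for j k
    using diag_matrix_vector[of \<mu> "z k" j] by (simp only: Tz vector_scaleR_component real_scaleR_def)
  \<comment> \<open>By \<open>eq\<close>, either the component \<open>z k $ j\<close> vanishes or
    \<open>\<nu> k = \<mu> j\<close>; an arbitrary function \<open>g\<close> is compatible with both
    cases.\<close>
  have eig: "g (\<nu> k) * z k $ j = g (\<mu> j) * z k $ j" for j k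
    using eq[of j k] by (cases "z k $ j = 0") simp_all
  have "(\<Sum>k\<in>UNIV. (g (\<nu> k) * (x \<bullet> z k)) *\<^sub>R z k) = (\<chi> k. g (\<mu> k) * x $ k)"
  proof (simp add: vec_eq_iff, intro allI)
    fix j
    have "(\<Sum>k\<in>UNIV. g (\<nu> k) * (x \<bullet> z k) * z k $ j) = (\<Sum>k\<in>UNIV. g (\<mu> j) * ((x \<bullet> z k) * z k $ j))"
    proof (rule sum.cong[OF refl])
      fix k
      have "g (\<nu> k) * (x \<bullet> z k) * z k $ j = (x \<bullet> z k) * (g (\<nu> k) * z k $ j)" by simp
      then show "g (\<nu> k) * (x \<bullet> z k) * z k $ j = g (\<mu> j) * ((x \<bullet> z k) * z k $ j)"
        unfolding eig by simp
    qed
    also have "\<dots> = g (\<mu> j) * (\<Sum>k\<in>UNIV. (x \<bullet> z k) *\<^sub>R z k) $ j"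
      by (simp add: sum_distrib_left)
    finally show "(\<Sum>k\<in>UNIV. g (\<nu> k) * (x \<bullet> z k) * z k $ j) = g (\<mu> j) * x $ j"
      by (simp add: orthonormal_expansion[OF orth])
  qed
  then have comb: "(\<chi> k. g (\<mu> k) * x $ k) = (\<Sum>k\<in>UNIV. (g (\<nu> k) * (x \<bullet> z k)) *\<^sub>R z k)" ..
  have lin: "A *v (\<Sum>k\<in>UNIV. c k *\<^sub>R z k) = (\<Sum>k\<in>UNIV. c k *\<^sub>R (A *v z k))" for c
    by (simp add: linear_sum[OF matrix_vector_mul_linear] matrix_vector_mult_scaleR)
  show ?thesis
    unfolding operator_function_def some comb lin
    by (simp add: z mass_A lincomb_sum[symmetric])
qed

end

section \<open>Linear images of standard Gaussian vectors\<close>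

lemma (in prob_space) gaussian_variable_sum:
  assumes indep: "indep_vars (\<lambda>_. borel) W (UNIV :: 'i::finite set)"
    and normal: "\<And>k. distributed M lborel (W k) std_normal_density"
  shows "gaussian_variable M (\<lambda>\<omega>. \<Sum>k\<in>UNIV. c k * W k \<omega>)"
proof -
  \<comment> \<open>A normal density requires a positive deviation, so zero coefficients are dropped
    first. If none remains, the sum is the constant 0, which counts as Gaussian.\<close>
  define K where "K = {k. c k \<noteq> 0}"
  have eq: "(\<Sum>k\<in>UNIV. c k * W k \<omega>) = (\<Sum>k\<in>K. c k * W k \<omega>)" for \<omega>
    unfolding K_def by (rule sum.mono_neutral_right) auto
  show ?thesis
  proof (cases "K = {}")
    case True
    then show ?thesis unfolding gaussian_variable_def eq by auto
  next
    case False
    have "indep_vars (\<lambda>_. borel) (\<lambda>k \<omega>. c k * W k \<omega>) K"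
      by (rule indep_vars_compose2[OF indep_vars_subset[OF indep subset_UNIV], of K "\<lambda>k x. c k * x"]) simp
    moreover have "distributed M lborel (\<lambda>\<omega>. c k * W k \<omega>) (normal_density 0 \<bar>c k\<bar>)" if "k \<in> K" for k
      using normal_density_affine[OF normal, of "c k" 0 k] that by (simp add: K_def)
    ultimately have "distributed M lborel (\<lambda>\<omega>. \<Sum>k\<in>K. c k * W k \<omega>)
        (normal_density (\<Sum>k\<in>K. 0) (sqrt (\<Sum>k\<in>K. \<bar>c k\<bar>\<^sup>2)))"
      using False by (intro sum_indep_normal) (auto simp: K_def)
    moreover have "0 < sqrt (\<Sum>k\<in>K. \<bar>c k\<bar>\<^sup>2)"
      using False by (auto simp: K_def intro!: sum_pos)
    ultimately show ?thesis unfolding gaussian_variable_def eq by blast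
  qed
qed

lemma (in prob_space) std_normal_moments:
  assumes indep: "indep_vars (\<lambda>_. borel) W (UNIV :: 'i::finite set)"
    and normal: "\<And>k. distributed M lborel (W k) std_normal_density"
  shows "integrable M (W k)" "expectation (W k) = 0" "integrable M (\<lambda>\<omega>. W k \<omega> * W l \<omega>)"
    "expectation (\<lambda>\<omega>. W k \<omega> * W l \<omega>) = (if k = l then 1 else 0)"
proof -
  show int: "integrable M (W k)" for k
    using integrable_std_normal_moment[of 1] distributed_integrable[OF normal, of "\<lambda>x. x" k]
    by (simp add: normal_density_nonneg)
  show exp: "expectation (W k) = 0" for k
    using standard_normal_distributed_expectation[OF normal] .
  have sq: "integrable M (\<lambda>\<omega>. W k \<omega> * W k \<omega>)" for k
    using integrable_std_normal_moment[of 2] distributed_integrable[OF normal, of "\<lambda>x. x\<^sup>2" k]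
    by (simp add: normal_density_nonneg power2_eq_square)
  have var: "expectation (\<lambda>\<omega>. W k \<omega> * W k \<omega>) = 1" for k
    using standard_normal_distributed_variance[OF normal, of k] exp[of k] by (simp add: power2_eq_square)
  \<comment> \<open>Pairwise independence is the case of a one-term sum in the independence of one
    variable from a sum of others.\<close>
  have iv: "indep_var borel (W k) borel (W l)" if "k \<noteq> l"
    using indep_vars_sum[of "{l}" k W] indep_vars_subset[OF indep subset_UNIV, of "{k, l}"] that by simp
  show "integrable M (\<lambda>\<omega>. W k \<omega> * W l \<omega>)"
    using sq indep_var_integrable[OF iv int int] by (cases "k = l") auto
  show "expectation (\<lambda>\<omega>. W k \<omega> * W l \<omega>) = (if k = l then 1 else 0)"
    using var indep_var_lebesgue_integral[OF iv int int] exp by auto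
qed

lemma (in prob_space) gaussian_linear_image:
  fixes L :: "real ^ 'n ^ 'm" and Z :: "'a \<Rightarrow> real ^ 'm"
  assumes indep: "indep_vars (\<lambda>_. borel) W (UNIV :: 'n::finite set)"
    and normal: "\<And>k. distributed M lborel (W k) std_normal_density"
    and Z: "\<And>\<omega>. \<omega> \<in> space M \<Longrightarrow> Z \<omega> = L *v (\<chi> k. W k \<omega>)"
  shows "gaussian_vector M Z" "centered_vector M Z" "covariance_matrix M Z = L ** transpose L"
proof -
  note moments = std_normal_moments[OF indep normal]
  have [measurable]: "W k \<in> borel_measurable M" for k
    using normal[of k] by (auto dest: distributed_measurable)
  \<comment> \<open>\<open>Z\<close> is known only on the sample space, so being Gaussian must be
    seen to depend on the values there alone.\<close>
  have cong: "gaussian_variable M X \<longleftrightarrow> gaussian_variable M Y" if "\<And>\<omega>. \<omega> \<in> space M \<Longrightarrow> X \<omega> = Y \<omega>" for X Y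
  proof -
    have "distributed M lborel X f \<longleftrightarrow> distributed M lborel Y f" for f
      using that unfolding distributed_def by (simp cong: distr_cong measurable_cong)
    moreover have "X \<in> borel_measurable M \<longleftrightarrow> Y \<in> borel_measurable M"
      using that by (rule measurable_cong)
    moreover have "(AE \<omega> in M. X \<omega> = m) \<longleftrightarrow> (AE \<omega> in M. Y \<omega> = m)" for m
      using that by (intro AE_cong) simp
    ultimately show ?thesis unfolding gaussian_variable_def by simp
  qed
  have Zk: "Z \<omega> $ i = (\<Sum>k\<in>UNIV. L $ i $ k * W k \<omega>)" if "\<omega> \<in> space M" for i \<omega>
    using Z[OF that] by (simp add: matrix_vector_mult_def)
  have exp: "expectation (\<lambda>\<omega>. Z \<omega> $ i) = 0" for i
  proof -
    have "expectation (\<lambda>\<omega>. Z \<omega> $ i) = expectation (\<lambda>\<omega>. \<Sum>k\<in>UNIV. L $ i $ k * W k \<omega>)"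
      by (intro Bochner_Integration.integral_cong refl Zk)
    then show ?thesis using moments by simp
  qed
  then show "centered_vector M Z" unfolding centered_vector_def by blast
  show "gaussian_vector M Z" unfolding gaussian_vector_def
  proof (intro conjI allI)
    have "(\<lambda>\<omega>. \<Sum>i\<in>UNIV. (\<Sum>k\<in>UNIV. L $ i $ k * W k \<omega>) *\<^sub>R axis i (1::real)) \<in> borel_measurable M"
      by (intro borel_measurable_sum borel_measurable_scaleR borel_measurable_times) simp_all
    moreover have "Z \<omega> = (\<Sum>i\<in>UNIV. (\<Sum>k\<in>UNIV. L $ i $ k * W k \<omega>) *\<^sub>R axis i 1)" if "\<omega> \<in> space M" for \<omega>
      using Zk[OF that] by (simp add: vec_eq_iff axis_def if_distrib[where f = "\<lambda>x. _ * x"] cong: if_cong)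
    ultimately show "Z \<in> borel_measurable M"
      by (simp cong: measurable_cong)
    fix a
    have "a \<bullet> Z \<omega> = (\<Sum>k\<in>UNIV. (\<Sum>i\<in>UNIV. a $ i * L $ i $ k) * W k \<omega>)" if "\<omega> \<in> space M" for \<omega>
      using Zk[OF that] by (simp add: inner_vec_def sum_distrib_left sum_distrib_right mult.assoc)
        (rule sum.swap)
    with gaussian_variable_sum[OF indep normal] show "gaussian_variable M (\<lambda>\<omega>. a \<bullet> Z \<omega>)"
      by (subst cong) 
  qed
  have "expectation (\<lambda>\<omega>. Z \<omega> $ i * Z \<omega> $ j) = (L ** transpose L) $ i $ j" for i j
  proof -
    have "expectation (\<lambda>\<omega>. Z \<omega> $ i * Z \<omega> $ j) =
        expectation (\<lambda>\<omega>. \<Sum>k\<in>UNIV. \<Sum>l\<in>UNIV. (L $ i $ k * L $ j $ l) * (W k \<omega> * W l \<omega>))"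
      by (intro Bochner_Integration.integral_cong refl) (simp add: Zk sum_product algebra_simps)
    \<comment> \<open>The covariance of the standard vector is the identity, so only the diagonal of
      the double sum survives.\<close>
    also have "\<dots> = (\<Sum>k\<in>UNIV. \<Sum>l\<in>UNIV. (L $ i $ k * L $ j $ l) * (if k = l then 1 else 0))"
      using moments by simp
    also have "\<dots> = (\<Sum>k\<in>UNIV. L $ i $ k * L $ j $ k)"
      by (simp add: if_distrib[where f = "\<lambda>x. _ * x"] cong: if_cong)
    finally show ?thesis by (simp add: matrix_matrix_mult_def transpose_def)
  qed
  then show "covariance_matrix M Z = L ** transpose L"
    by (simp add: covariance_matrix_def exp vec_eq_iff)
qed

section \<open>The Gram matrices of the discretization\<close>

text \<open>Both claims go through one induction: linearity of \<open>D\<close> may be applied to a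
  partial sum only once that sum is known to lie in the energy space.\<close>

lemma field_inner_gradient_sum:
  fixes M :: "('a, 'd::finite) riem"
  assumes M: "compact_riemannian_manifold M" and vol: "riemannian_volume M vol"
    and D: "gradient_on_h1 M vol lam e D" and e: "l2_orthonormal vol e" and mono: "mono lam"
    and J: "finite J" and \<psi>: "\<And>j. j \<in> J \<Longrightarrow> \<psi> j \<in> h1_space vol lam e" and h: "h \<in> h1_space vol lam e"
  shows "(\<lambda>x. \<Sum>j\<in>J. a j * \<psi> j x) \<in> h1_space vol lam e \<and>
    field_inner M vol (D (\<lambda>x. \<Sum>j\<in>J. a j * \<psi> j x)) (D h) = (\<Sum>j\<in>J. a j * field_inner M vol (D (\<psi> j)) (D h))"
proof -
  let ?H = "h1_space vol lam e"
  note sub = l2_orthonormal.h1_space_lincomb[OF e mono]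
  have sq: "sq_integrable_field M vol (D f)" if "f \<in> ?H" for f
    using D that unfolding gradient_on_h1_def by blast
  have lin: "AE p in vol. \<forall>c\<in>charts M. p \<in> fst c \<longrightarrow> D (\<lambda>x. a * f x + b * g x) c p = a *\<^sub>R D f c p + b *\<^sub>R D g c p"
    if "f \<in> ?H" "g \<in> ?H" for f g a b
    using D that unfolding gradient_on_h1_def by blast
  have inner: "field_inner M vol (D (\<lambda>x. a * f x + b * g x)) (D h) =
      a * field_inner M vol (D f) (D h) + b * field_inner M vol (D g) (D h)"
    if "f \<in> ?H" "g \<in> ?H" for f g a b
    by (rule field_inner_lincomb_left[OF M vol sq sq sq sq lin]) (intro that h sub)+
  show ?thesis using J \<psi>
  proof (induction J)
    case empty
    \<comment> \<open>The empty sum is written as \<open>0 * h + 0 * h\<close>, because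
      \<open>D\<close> of the zero function is known only through linearity.\<close>
    show ?case using sub[OF h h, of 0 0] inner[OF h h, of 0 0] by simp
  next
    case (insert j J)
    then show ?case
      using sub[of "\<psi> j" "\<lambda>x. \<Sum>j\<in>J. a j * \<psi> j x" "a j" 1]
        inner[of "\<psi> j" "\<lambda>x. \<Sum>j\<in>J. a j * \<psi> j x" "a j" 1] by simp
  qed
qed

lemma l2_inner_lincomb:
  assumes "\<And>j. sq_integrable vol (\<psi> j)"
  shows "l2_inner vol (lincomb \<psi> a) (lincomb \<psi> b) = a \<bullet> (mass_matrix vol \<psi> *v b)"
proof -
  have right: "l2_inner vol (\<psi> i) (lincomb \<psi> b) = (\<Sum>j\<in>UNIV. l2_inner vol (\<psi> i) (\<psi> j) * b $ j)" for i
    unfolding lincomb_def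
    by (subst l2_inner_commute, subst l2_inner_sum_left[OF assms assms]) (simp add: l2_inner_commute mult.commute)
  have "l2_inner vol (lincomb \<psi> a) (lincomb \<psi> b) = (\<Sum>i\<in>UNIV. a $ i * l2_inner vol (\<psi> i) (lincomb \<psi> b))"
    unfolding lincomb_def[of \<psi> a]
    by (intro l2_inner_sum_left assms) (auto simp: lincomb_def intro: sq_integrable_sum assms)
  then show ?thesis
    by (simp add: right inner_vec_def matrix_vector_mult_def mass_matrix_def)
qed

lemma field_inner_lincomb:
  fixes M :: "('a, 'd::finite) riem"
  assumes M: "compact_riemannian_manifold M" and vol: "riemannian_volume M vol"
    and D: "gradient_on_h1 M vol lam e D" and e: "l2_orthonormal vol e" and mono: "mono lam"
    and \<psi>: "\<And>j. \<psi> j \<in> h1_space vol lam e"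
  shows "field_inner M vol (D (lincomb \<psi> a)) (D (lincomb \<psi> b)) = b \<bullet> (stiffness_matrix M vol D \<psi> *v a)"
proof -
  note sum = field_inner_gradient_sum[OF M vol D e mono finite, where J = UNIV and \<psi> = \<psi>, OF \<psi>]
  have H: "lincomb \<psi> c \<in> h1_space vol lam e" for c
    unfolding lincomb_def using sum[OF \<psi>] by blast
  have comm: "field_inner M vol (D f) (D h) = field_inner M vol (D h) (D f)"
    if "f \<in> h1_space vol lam e" "h \<in> h1_space vol lam e" for f h
    using D that unfolding gradient_on_h1_def by (intro field_inner_commute[OF M vol]) auto
  have left: "field_inner M vol (D (lincomb \<psi> c)) (D h) = (\<Sum>j\<in>UNIV. c $ j * field_inner M vol (D (\<psi> j)) (D h))"
    if "h \<in> h1_space vol lam e" for c h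
    unfolding lincomb_def using sum[OF that] by blast
  have right: "field_inner M vol (D (\<psi> i)) (D (lincomb \<psi> a)) =
      (\<Sum>j\<in>UNIV. field_inner M vol (D (\<psi> i)) (D (\<psi> j)) * a $ j)" for i
    by (subst comm[OF \<psi> H], subst left[OF \<psi>], intro sum.cong refl)
      (simp only: comm[OF \<psi> \<psi>, of _ i] mult.commute)
  have "field_inner M vol (D (lincomb \<psi> a)) (D (lincomb \<psi> b)) =
      (\<Sum>i\<in>UNIV. b $ i * field_inner M vol (D (\<psi> i)) (D (lincomb \<psi> a)))"
    by (subst comm[OF H H]) (rule left[OF H])
  then show ?thesis
    by (simp add: right inner_vec_def matrix_vector_mult_def stiffness_matrix_def)
qed

text \<open>The kernel is trivial: if \<open>C a = 0\<close>, then
  \<open>a \<bullet> (C *v a)\<close>, the square norm of \<open>lincomb \<psi> a\<close>, vanishes,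
  and independence forces \<open>a = 0\<close>.\<close>

lemma mass_matrix_invertible:
  assumes "\<And>j. sq_integrable vol (\<psi> j)" "l2_independent vol \<psi>"
  shows "invertible (mass_matrix vol \<psi>)"
proof -
  have "a = 0" if "mass_matrix vol \<psi> *v a = 0" for a
  proof (rule lincomb_inj[OF assms(2)])
    have "l2_inner vol (lincomb \<psi> a) (lincomb \<psi> a) = 0"
      by (simp add: l2_inner_lincomb[OF assms(1)] that)
    then have "AE x in vol. lincomb \<psi> a x = 0"
      by (rule l2_inner_eq_0_imp_AE[rotated]) (auto simp: lincomb_def intro: sq_integrable_sum assms(1))
    then show "AE x in vol. lincomb \<psi> a x = lincomb \<psi> 0 x"
      by (simp add: lincomb_def)
  qed
  then show ?thesis
    unfolding invertible_left_inverse matrix_left_invertible_ker by blast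
qed

section \<open>Representation and covariance of the discretized field\<close>

theorem theorem3p4:
  fixes M :: "('a, 'd::finite) riem"
    and vol :: "'a measure"
    and lam :: "nat \<Rightarrow> real"
    and e :: "nat \<Rightarrow> 'a \<Rightarrow> real"
    and D :: "('a \<Rightarrow> real) \<Rightarrow> ('a, 'd) field"
    and \<alpha> \<beta> :: real
    and \<gamma> :: "real \<Rightarrow> real"
    and \<psi> :: "'n::{finite, linorder} \<Rightarrow> 'a \<Rightarrow> real"
    and sqrtC S V :: "real ^ ('n::{finite, linorder}) ^ ('n::{finite, linorder})"
    and lamn :: "'n \<Rightarrow> real"
    and en :: "'n \<Rightarrow> 'a \<Rightarrow> real"
    and P :: "'w measure"
    and W :: "'n \<Rightarrow> 'w \<Rightarrow> real"
    and Wn Zn :: "'w \<Rightarrow> 'a \<Rightarrow> real"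
  assumes manifold: "compact_riemannian_manifold M"
    and volume: "riemannian_volume M vol"
    and eigenpairs: "laplace_eigenpairs M vol lam e"
    and gradient: "gradient_on_h1 M vol lam e D"
    and alpha: "\<alpha> = 2 / real CARD('d)"
    and psd: "power_spectral_density \<beta> \<gamma>"
    and exponent: "2 * \<alpha> * \<beta> - 1 > 0"
    and basis: "galerkin_basis vol lam e \<psi>"
    and sqrtC: "sqrtC ** transpose sqrtC = mass_matrix vol \<psi>"
    and S: "S = matrix_inv sqrtC ** stiffness_matrix M vol D \<psi> ** matrix_inv (transpose sqrtC)"
    and V: "orthogonal_matrix V"
    and lamn: "mono lamn"
    and diagonalization: "S = V ** diag_matrix lamn ** transpose V"
    and en: "\<And>k. en k = discrete_eigenfunction sqrtC V \<psi> k"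
    and prob: "prob_space P"
    and indep: "prob_space.indep_vars P (\<lambda>_. borel) W UNIV"
    and normal: "\<And>k. distributed P lborel (W k) std_normal_density"
    and Wn: "\<And>\<omega>. Wn \<omega> = (\<lambda>x. \<Sum>k\<in>UNIV. W k \<omega> * en k x)"
    and Zn: "\<And>\<omega>. Zn \<omega> = operator_function \<gamma> vol \<psi> (discrete_neg_laplacian M vol D \<psi>) (Wn \<omega>)"
  shows "(\<forall>\<omega>\<in>space P. AE x in vol. Zn \<omega> x = (\<Sum>k\<in>UNIV. \<gamma> (lamn k) * W k \<omega> * en k x)) \<and>
    (\<exists>Z :: 'w \<Rightarrow> real ^ ('n::{finite, linorder}). \<forall>\<omega>\<in>space P. AE x in vol. Zn \<omega> x = (\<Sum>k\<in>UNIV. Z \<omega> $ k * \<psi> k x)) \<and>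
    (\<forall>Z :: 'w \<Rightarrow> real ^ ('n::{finite, linorder}).
       (\<forall>\<omega>\<in>space P. AE x in vol. Zn \<omega> x = (\<Sum>k\<in>UNIV. Z \<omega> $ k * \<psi> k x)) \<longrightarrow>
       gaussian_vector P Z \<and> centered_vector P Z \<and>
       covariance_matrix P Z =
         matrix_inv (transpose sqrtC) **
         (V ** diag_matrix (\<lambda>k. (\<gamma> (lamn k))\<^sup>2) ** transpose V) **
         matrix_inv sqrtC)"
proof -
  interpret P: prob_space P by (rule prob)
  interpret e: l2_orthonormal vol e
    using eigenpairs unfolding laplace_eigenpairs_def l2_orthonormal_def by blast
  have mono: "mono lam" using eigenpairs unfolding laplace_eigenpairs_def by blast
  have \<psi>: "\<psi> j \<in> h1_space vol lam e" for j
    using basis unfolding galerkin_basis_def by blast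
  then have sq: "sq_integrable vol (\<psi> j)" for j
    unfolding h1_space_def by blast
  have ind: "l2_independent vol \<psi>" using basis unfolding galerkin_basis_def by blast
  let ?C = "mass_matrix vol \<psi>" and ?R = "stiffness_matrix M vol D \<psi>"

  \<comment> \<open>Invertibility is inherited from the mass matrix: \<open>sqrtC\<close> has the
    right inverse \<open>sqrtC\<^sup>T C\<^sup>-\<^sup>1\<close>, and it is square.\<close>
  have inv: "invertible sqrtC"
  proof -
    have "sqrtC ** (transpose sqrtC ** matrix_inv ?C) = mat 1"
      by (simp add: matrix_mul_assoc sqrtC matrix_inv_right[OF mass_matrix_invertible[OF sq ind]])
    then show ?thesis unfolding invertible_right_inverse by blast
  qed
  define B where "B = matrix_inv sqrtC"
  have BsC: "B ** sqrtC = mat 1" unfolding B_def by (rule matrix_inv_left[OF inv])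
  have Bt: "matrix_inv (transpose sqrtC) = transpose B"
    unfolding B_def by (rule matrix_inv_transpose[OF inv])
  have tBsC: "transpose sqrtC ** transpose B = mat 1"
    by (simp add: matrix_transpose_mul[symmetric] BsC)
  have V': "transpose V ** V = mat 1" using V unfolding orthogonal_matrix_def by blast
  define A where "A = transpose B ** V"
  \<comment> \<open>Substituting \<open>C = sqrtC sqrtC\<^sup>T\<close> lets \<open>B\<close> cancel
    each factor, which leaves \<open>V\<^sup>T V\<close>.\<close>
  have AC: "transpose A ** ?C ** A = mat 1"
  proof -
    have "transpose A ** ?C ** A = transpose V ** (B ** sqrtC) ** (transpose sqrtC ** transpose B) ** V"
      by (simp add: A_def sqrtC[symmetric] matrix_transpose_mul matrix_mul_assoc)
    then show ?thesis by (simp add: BsC tBsC V')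
  qed
  have AR: "transpose A ** ?R ** A = diag_matrix lamn"
  proof -
    have "transpose A ** ?R ** A = transpose V ** S ** V"
      by (simp add: A_def S Bt B_def[symmetric] matrix_transpose_mul matrix_mul_assoc)
    also have "\<dots> = (transpose V ** V) ** diag_matrix lamn ** (transpose V ** V)"
      by (simp add: diagonalization matrix_mul_assoc)
    finally show ?thesis by (simp add: V')
  qed
  interpret G: galerkin_eigenproblem M vol D \<psi> ?C ?R A lamn
    by unfold_locales (fact ind, rule l2_inner_lincomb[OF sq],
      rule field_inner_lincomb[OF manifold volume gradient e.l2_orthonormal_axioms mono \<psi>], fact AC, fact AR)

  have en': "en k = lincomb \<psi> (A *v axis k 1)" for k
    by (simp only: en discrete_eigenfunction_def lincomb_def A_def Bt matrix_vector_mult_basis[symmetric] matrix_vector_mul_assoc)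
  have expand: "(\<lambda>x. \<Sum>k\<in>UNIV. c k * en k x) = lincomb \<psi> (A *v (\<chi> k. c k))" for c
    unfolding en' lincomb_sum[symmetric]
    by (simp only: matrix_mult_sum[of A "\<chi> k. c k"] matrix_vector_mult_basis scalar_mult_eq_scaleR vec_lambda_beta)
  define L where "L = A ** diag_matrix (\<lambda>k. \<gamma> (lamn k))"
  have diag: "(\<chi> k. \<gamma> (lamn k) * W k \<omega>) = diag_matrix (\<lambda>k. \<gamma> (lamn k)) *v (\<chi> k. W k \<omega>)" for \<omega>
    by (simp add: vec_eq_iff diag_matrix_vector)
  have Zn_en: "Zn \<omega> = (\<lambda>x. \<Sum>k\<in>UNIV. \<gamma> (lamn k) * W k \<omega> * en k x)" for \<omega>
    unfolding Zn Wn expand by (simp add: G.operator_function_A)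
  have Zn_L: "Zn \<omega> = lincomb \<psi> (L *v (\<chi> k. W k \<omega>))" for \<omega>
    unfolding Zn_en expand by (simp add: diag L_def matrix_vector_mul_assoc)
  have LL: "L ** transpose L =
      matrix_inv (transpose sqrtC) ** (V ** diag_matrix (\<lambda>k. (\<gamma> (lamn k))\<^sup>2) ** transpose V) ** matrix_inv sqrtC"
  proof -
    have "L ** transpose L = A ** (diag_matrix (\<lambda>k. \<gamma> (lamn k)) ** diag_matrix (\<lambda>k. \<gamma> (lamn k))) ** transpose A"
      by (simp add: L_def matrix_transpose_mul transpose_diag_matrix matrix_mul_assoc)
    then show ?thesis
      by (simp add: diag_matrix_mult power2_eq_square A_def Bt B_def[symmetric] matrix_transpose_mul matrix_mul_assoc)
  qed

  show ?thesis
  proof (intro conjI ballI allI impI)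
    show "AE x in vol. Zn \<omega> x = (\<Sum>k\<in>UNIV. \<gamma> (lamn k) * W k \<omega> * en k x)" for \<omega>
      by (simp add: Zn_en)
    show "\<exists>Z :: 'w \<Rightarrow> real ^ ('n::{finite, linorder}). \<forall>\<omega>\<in>space P. AE x in vol. Zn \<omega> x = (\<Sum>k\<in>UNIV. Z \<omega> $ k * \<psi> k x)"
      by (rule exI[of _ "\<lambda>\<omega>. L *v (\<chi> k. W k \<omega>)"]) (simp add: Zn_L lincomb_def)
  next
    fix Z :: "'w \<Rightarrow> real ^ ('n::{finite, linorder})"
    assume Z: "\<forall>\<omega>\<in>space P. AE x in vol. Zn \<omega> x = (\<Sum>k\<in>UNIV. Z \<omega> $ k * \<psi> k x)"
    \<comment> \<open>Independence of the \<open>\<psi> j\<close> pins down any admissible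
      \<open>Z\<close> at each sample point, so the result for linear images applies to it.\<close>
    have "Z \<omega> = L *v (\<chi> k. W k \<omega>)" if "\<omega> \<in> space P" for \<omega>
    proof (rule lincomb_inj[OF ind])
      have "AE x in vol. Zn \<omega> x = lincomb \<psi> (Z \<omega>) x" using Z that unfolding lincomb_def by blast
      then show "AE x in vol. lincomb \<psi> (Z \<omega>) x = lincomb \<psi> (L *v (\<chi> k. W k \<omega>)) x"
        unfolding Zn_L by eventually_elim simp
    qed
    note image = P.gaussian_linear_image[OF indep normal this]
    show "gaussian_vector P Z" by (rule image(1))
    show "centered_vector P Z" by (rule image(2))
    show "covariance_matrix P Z =
        matrix_inv (transpose sqrtC) ** (V ** diag_matrix (\<lambda>k. (\<gamma> (lamn k))\<^sup>2) ** transpose V) ** matrix_inv sqrtC"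
      using image(3) unfolding LL .
  qed
qed

end
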